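(* Let $M$ be a screen generic lightlike submanifold of a locally bronze semi-Riemannian manifold $(\bar M,\bar g,\bar J)$ with an $(l,m)$-type connection $\bar\Omega$. Then the distribution $B_o$ is integrable if and only if both of the following hold for all $X,Y\in\Gamma(B_o)$, $Z\in\Gamma(B')$ and $N\in\Gamma(\mathrm{ltr}(TM))$: (i) $\bar g(\bar h^{*}(X,\bar JY),\bar JN)+3\bar g(\bar h^{*}(Y,\bar JX),N)=\bar g(\bar h^{*}(Y,\bar JX),\bar JN)+3\bar g(\bar h^{*}(X,\bar JY),N)$; (ii) $\bar g(\Omega^{*}_X\bar JY,fZ)+\bar g(\bar h^{s}(X,\bar JY),\bar JZ)+3\bar g(\Omega^{*}_Y\bar JX,Z)=\bar g(\Omega^{*}_Y\bar JX,fZ)+\bar g(\bar h^{s}(Y,\bar JX),\bar JZ)+3\bar g(\Omega^{*}_X\bar JY,Z)$.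
   Context: Bronze manifold: a semi-Riemannian manifold $(\bar M,\bar g)$ (of constant index $q$, $1\le q\le \dim\bar M-1$) with a $(1,1)$-tensor field $\bar J$ satisfying $\bar J^2=3\bar J+I$ and $\bar g(\bar JX,Y)=\bar g(X,\bar JY)$; it is locally bronze if $\bar\nabla\bar J=0$ for the Levi-Civita connection $\bar\nabla$. Lightlike submanifold: $M\subset\bar M$ such that $\mathrm{Rad}\,TM=TM\cap TM^\perp$ is a distribution of constant rank $r>0$; $g$ is the induced metric. One fixes $S(TM)$, $S(TM^\perp)$ with $TM=\mathrm{Rad}\,TM\perp S(TM)$, $TM^\perp=\mathrm{Rad}\,TM\perp S(TM^\perp)$, and a lightlike transversal bundle $\mathrm{ltr}(TM)$ (locally spanned by $N_1,\dots,N_r$ in $S(TM^\perp)^\perp$, orthogonal to $S(TM)$, with $\bar g(N_i,\xi_j)=\delta_{ij}$, $\bar g(N_i,N_j)=0$ for a local basis $\xi_1,\dots,\xi_r$ of $\mathrm{Rad}\,TM$). Then $T\bar M|_M=TM\oplus \mathrm{tr}(TM)$ with $\mathrm{tr}(TM)=\mathrm{ltr}(TM)\perp S(TM^\perp)$. For $X\in\Gamma(TM)$ write $\bar JX=fX+wX$ with $fX$ tangential and $wX\in\Gamma(\mathrm{tr}(TM))$. Screen generic: $M$ is screen generic if $\bar J(\mathrm{Rad}\,TM)=\mathrm{Rad}\,TM$ and $B_o=\bar J(S(TM))\cap S(TM)$ is a non-degenerate distribution; $B'$ denotes the complementary (orthogonal) non-degenerate distribution in $S(TM)$, so $S(TM)=B_o\oplus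 B'$, with (when $B'\neq\{0\}$) $\bar J(B')\not\subseteq S(TM)$ and $\bar J(B')\not\subseteq S(TM^\perp)$, and $fY\in\Gamma(B')$, $wY\in\Gamma(S(TM^\perp))$ for $Y\in\Gamma(B')$. $(l,m)$-type connection: let $l,m$ be smooth functions on $\bar M$, $(l,m)\ne(0,0)$, $\eta$ a smooth unit spacelike vector field on $\bar M$, $\theta(X)=\bar g(X,\eta)$. Then $\bar\Omega_XY=\bar\nabla_XY+\theta(Y)\{lX+m\bar JX\}$. Induced objects: for $X,Y\in\Gamma(TM)$, $\bar\Omega_XY=\Omega_XY+\bar h^{l}(X,Y)+\bar h^{s}(X,Y)$ with components in $TM$, $\mathrm{ltr}(TM)$, $S(TM^\perp)$ respectively; for $Y\in\Gamma(S(TM))$, $\Omega_XY=\Omega^{*}_XY+\bar h^{*}(X,Y)$ with $\Omega^*_XY\in\Gamma(S(TM))$, $\bar h^*(X,Y)\in\Gamma(\mathrm{Rad}\,TM)$. A distribution is integrable if it is closed under the Lie bracket of its sections. *)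

theory Defs
  imports "HOL-Analysis.Analysis"
begin

section \<open>Smooth functions between Euclidean spaces\<close>

text \<open>Both notions are meant for open sets \<open>S\<close> only.\<close>

fun Ck_on :: "nat \<Rightarrow> 'v::real_normed_vector set \<Rightarrow> ('v \<Rightarrow> 'w::real_normed_vector) \<Rightarrow> bool" where
  "Ck_on 0 S f \<longleftrightarrow> continuous_on S f"
| "Ck_on (Suc k) S f \<longleftrightarrow>
     (\<forall>x\<in>S. f differentiable (at x)) \<and> (\<forall>v. Ck_on k S (\<lambda>x. frechet_derivative f (at x) v))"

definition smooth_on :: "'v::real_normed_vector set \<Rightarrow> ('v \<Rightarrow> 'w::real_normed_vector) \<Rightarrow> bool" where
  "smooth_on S f \<longleftrightarrow> (\<forall>k. Ck_on k S f)"

section \<open>Smooth manifolds\<close>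

text \<open>A manifold is a whole type \<open>'a\<close>, Hausdorff and second countable by its type classes, with
  an atlas \<open>A\<close> of charts into the model space \<open>'e\<close>; its dimension is \<open>DIM('e)\<close>. A chart is a pair
  of its domain and its coordinate map; values of the latter outside the domain are irrelevant.\<close>

type_synonym ('a, 'e) chart = "'a set \<times> ('a \<Rightarrow> 'e)"

definition chart_inv :: "('a, 'e) chart \<Rightarrow> 'e \<Rightarrow> 'a" where
  "chart_inv c = inv_into (fst c) (snd c)"

definition smooth_manifold ::
  "('a::{t2_space,second_countable_topology}, 'e::euclidean_space) chart set \<Rightarrow> bool" where
  "smooth_manifold A \<longleftrightarrow>
     (\<Union>c\<in>A. fst c) = UNIV \<and>
     (\<forall>c\<in>A. open (fst c) \<and> open (snd c ` fst c) \<and>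
        homeomorphism (fst c) (snd c ` fst c) (snd c) (chart_inv c)) \<and>
     (\<forall>c\<in>A. \<forall>d\<in>A. smooth_on (snd c ` (fst c \<inter> fst d)) (snd d \<circ> chart_inv c))"

text \<open>Tangent spaces: for each point \<open>p\<close> one chart \<open>chart_at A p\<close> around \<open>p\<close> is chosen once and
  for all, and the tangent space at \<open>p\<close> is the model space \<open>'e\<close>, a tangent vector being given by its
  components with respect to \<open>chart_at A p\<close>. Its components with respect to any other
  chart \<open>c\<close> around \<open>p\<close> are given by \<open>chart_coords A c p\<close>. A vector field is thus a map \<open>'a \<Rightarrow> 'e\<close>,
  and it is smooth if its components with respect to every (fixed) chart of the atlas are smooth.
  The map itself need not even be continuous, as the chosen chart jumps from point to point.\<close>

definition chart_at :: "('a, 'e) chart set \<Rightarrow> 'a \<Rightarrow> ('a, 'e) chart" where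
  "chart_at A p = (SOME c. c \<in> A \<and> p \<in> fst c)"

definition transition ::
  "('a, 'e::euclidean_space) chart \<Rightarrow> ('a, 'e) chart \<Rightarrow> 'a \<Rightarrow> 'e \<Rightarrow> 'e" where
  "transition c d p v = frechet_derivative (snd d \<circ> chart_inv c) (at (snd c p)) v"

definition chart_coords ::
  "('a, 'e::euclidean_space) chart set \<Rightarrow> ('a, 'e) chart \<Rightarrow> 'a \<Rightarrow> 'e \<Rightarrow> 'e" where
  "chart_coords A c p v = transition (chart_at A p) c p v"

text \<open>For \<open>b \<in> Basis\<close> this is the coordinate vector field of the chart \<open>c\<close> belonging to \<open>b\<close>.\<close>

definition coord_field ::
  "('a, 'e::euclidean_space) chart set \<Rightarrow> ('a, 'e) chart \<Rightarrow> 'e \<Rightarrow> 'a \<Rightarrow> 'e" where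
  "coord_field A c b p = transition c (chart_at A p) p b"

definition smooth_fun_on ::
  "('a, 'e::euclidean_space) chart set \<Rightarrow> 'a set \<Rightarrow> ('a \<Rightarrow> 'w::real_normed_vector) \<Rightarrow> bool" where
  "smooth_fun_on A U f \<longleftrightarrow> (\<forall>c\<in>A. smooth_on (snd c ` (U \<inter> fst c)) (f \<circ> chart_inv c))"

definition dir_deriv ::
  "('a, 'e::euclidean_space) chart set \<Rightarrow> ('a \<Rightarrow> 'w::real_normed_vector) \<Rightarrow> 'a \<Rightarrow> 'e \<Rightarrow> 'w" where
  "dir_deriv A f p u = frechet_derivative (f \<circ> chart_inv (chart_at A p)) (at (snd (chart_at A p) p)) u"

section \<open>Maps, and vector fields along maps\<close>

text \<open>From here on \<open>A\<close> is an atlas of the manifold \<open>'b\<close>, \<open>A'\<close> an atlas of the ambient manifold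
  \<open>'a\<close>, and \<open>i :: 'b \<Rightarrow> 'a\<close>.\<close>

definition smooth_map ::
  "('b::topological_space, 'm::euclidean_space) chart set \<Rightarrow>
   ('a::topological_space, 'e::euclidean_space) chart set \<Rightarrow> ('b \<Rightarrow> 'a) \<Rightarrow> bool" where
  "smooth_map A A' i \<longleftrightarrow>
     continuous_on UNIV i \<and> (\<forall>d\<in>A'. smooth_fun_on A (i -` fst d) (snd d \<circ> i))"

definition differential ::
  "('b, 'm::euclidean_space) chart set \<Rightarrow> ('a, 'e::euclidean_space) chart set \<Rightarrow> ('b \<Rightarrow> 'a) \<Rightarrow>
   'b \<Rightarrow> 'm \<Rightarrow> 'e" where
  "differential A A' i p u = dir_deriv A (snd (chart_at A' (i p)) \<circ> i) p u"

text \<open>The value \<open>V p\<close> of a field along \<open>i\<close> is a tangent vector of the ambient manifold at \<open>i p\<close>.\<close>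

definition smooth_along ::
  "('b, 'm::euclidean_space) chart set \<Rightarrow> ('a, 'e::euclidean_space) chart set \<Rightarrow> ('b \<Rightarrow> 'a) \<Rightarrow>
   'b set \<Rightarrow> ('b \<Rightarrow> 'e) \<Rightarrow> bool" where
  "smooth_along A A' i U V \<longleftrightarrow>
     (\<forall>d\<in>A'. smooth_fun_on A (U \<inter> i -` fst d) (\<lambda>p. chart_coords A' d (i p) (V p)))"

definition smooth_field ::
  "('a, 'e::euclidean_space) chart set \<Rightarrow> 'a set \<Rightarrow> ('a \<Rightarrow> 'e) \<Rightarrow> bool" where
  "smooth_field A U X \<longleftrightarrow> smooth_along A A id U X"

text \<open>The usual coordinate formula, in the chart \<open>chart_at A p\<close>.\<close>

definition lie_bracket ::
  "('a, 'e::euclidean_space) chart set \<Rightarrow> ('a \<Rightarrow> 'e) \<Rightarrow> ('a \<Rightarrow> 'e) \<Rightarrow> 'a \<Rightarrow> 'e" where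
  "lie_bracket A X Y p =
     dir_deriv A (\<lambda>q. chart_coords A (chart_at A p) q (Y q)) p (X p)
   - dir_deriv A (\<lambda>q. chart_coords A (chart_at A p) q (X q)) p (Y p)"

text \<open>A smooth family of \<open>k\<close>-dimensional subspaces of the ambient tangent spaces along \<open>i\<close>.\<close>

definition smooth_subbundle ::
  "('b::topological_space, 'm::euclidean_space) chart set \<Rightarrow> ('a, 'e::euclidean_space) chart set \<Rightarrow>
   ('b \<Rightarrow> 'a) \<Rightarrow> nat \<Rightarrow> ('b \<Rightarrow> 'e set) \<Rightarrow> bool" where
  "smooth_subbundle A A' i k E \<longleftrightarrow>
     (\<forall>p. \<exists>U F. open U \<and> p \<in> U \<and> (\<forall>j<k. smooth_along A A' i U (F j)) \<and>
        (\<forall>q\<in>U. inj_on (\<lambda>j::nat. F j q) {..<k} \<and> independent ((\<lambda>j. F j q) ` {..<k}) \<and>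
                span ((\<lambda>j. F j q) ` {..<k}) = E q))"

definition smooth_distribution ::
  "('b::topological_space, 'm::euclidean_space) chart set \<Rightarrow> ('a, 'e::euclidean_space) chart set \<Rightarrow>
   ('b \<Rightarrow> 'a) \<Rightarrow> ('b \<Rightarrow> 'e set) \<Rightarrow> bool" where
  "smooth_distribution A A' i E \<longleftrightarrow> (\<exists>k. smooth_subbundle A A' i k E)"

definition sections ::
  "('b, 'm::euclidean_space) chart set \<Rightarrow> ('a, 'e::euclidean_space) chart set \<Rightarrow> ('b \<Rightarrow> 'a) \<Rightarrow>
   ('b \<Rightarrow> 'e set) \<Rightarrow> ('b \<Rightarrow> 'e) set" where
  "sections A A' i E = {V. smooth_along A A' i UNIV V \<and> (\<forall>p. V p \<in> E p)}"

text \<open>For an immersion \<open>i\<close> and a distribution \<open>E\<close> tangent to the submanifold, a section of \<open>E\<close> may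
  equally be regarded as a vector field on \<open>'b\<close> whose push-forward takes values in \<open>E\<close>. This form is
  used wherever the section serves as a direction of differentiation or in a Lie bracket.\<close>

definition tangent_sections ::
  "('b, 'm::euclidean_space) chart set \<Rightarrow> ('a, 'e::euclidean_space) chart set \<Rightarrow> ('b \<Rightarrow> 'a) \<Rightarrow>
   ('b \<Rightarrow> 'e set) \<Rightarrow> ('b \<Rightarrow> 'm) set" where
  "tangent_sections A A' i E =
     {X. smooth_field A UNIV X \<and> (\<forall>p. differential A A' i p (X p) \<in> E p)}"

definition integrable_distribution ::
  "('b, 'm::euclidean_space) chart set \<Rightarrow> ('a, 'e::euclidean_space) chart set \<Rightarrow> ('b \<Rightarrow> 'a) \<Rightarrow>
   ('b \<Rightarrow> 'e set) \<Rightarrow> bool" where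
  "integrable_distribution A A' i E \<longleftrightarrow>
     (\<forall>X\<in>tangent_sections A A' i E. \<forall>Y\<in>tangent_sections A A' i E.
        lie_bracket A X Y \<in> tangent_sections A A' i E)"

section \<open>Connections\<close>

text \<open>\<open>nabla p u Y\<close> is the derivative at \<open>p\<close>, in the direction of the tangent vector \<open>u\<close>, of a vector
  field \<open>Y\<close> that is smooth near \<open>p\<close>. The Leibniz rule for functions that are smooth merely near \<open>p\<close>
  makes this depend only on the germ of \<open>Y\<close> at \<open>p\<close>.\<close>

definition affine_connection ::
  "('a::topological_space, 'e::euclidean_space) chart set \<Rightarrow> ('a \<Rightarrow> 'e \<Rightarrow> ('a \<Rightarrow> 'e) \<Rightarrow> 'e) \<Rightarrow> bool" where
  "affine_connection A nabla \<longleftrightarrow>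
     (\<forall>U Y. open U \<longrightarrow> smooth_field A U Y \<longrightarrow>
        (\<forall>p\<in>U. linear (\<lambda>u. nabla p u Y)) \<and>
        (\<forall>X. smooth_field A U X \<longrightarrow> smooth_field A U (\<lambda>p. nabla p (X p) Y)) \<and>
        (\<forall>Z. smooth_field A U Z \<longrightarrow>
           (\<forall>p\<in>U. \<forall>u. nabla p u (\<lambda>q. Y q + Z q) = nabla p u Y + nabla p u Z)) \<and>
        (\<forall>f::'a \<Rightarrow> real. smooth_fun_on A U f \<longrightarrow>
           (\<forall>p\<in>U. \<forall>u. nabla p u (\<lambda>q. f q *\<^sub>R Y q) = dir_deriv A f p u *\<^sub>R Y p + f p *\<^sub>R nabla p u Y)))"

text \<open>The covariant derivative of a field \<open>V\<close> along \<open>i\<close> in the direction \<open>u\<close> at \<open>p\<close>, i.e. the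
  pull-back connection. With \<open>\<partial>\<^sub>b\<close> the coordinate fields of the chart \<open>chart_at A' (i p)\<close> one has
  \<open>V = \<Sum>\<^sub>b V\<^sup>b (\<partial>\<^sub>b \<circ> i)\<close> near \<open>p\<close>, and the Leibniz rule gives
  \<open>\<Sum>\<^sub>b u(V\<^sup>b) \<partial>\<^sub>b + V\<^sup>b nabla\<^bsub>di(u)\<^esub> \<partial>\<^sub>b\<close>. If \<open>V = Y \<circ> i\<close> near \<open>p\<close> for an ambient
  field \<open>Y\<close>, this is \<open>nabla (i p) (di u) Y\<close>, the derivative of any local extension of \<open>V\<close>.\<close>

definition cov_along ::
  "('b, 'm::euclidean_space) chart set \<Rightarrow> ('a, 'e::euclidean_space) chart set \<Rightarrow> ('b \<Rightarrow> 'a) \<Rightarrow>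
   ('a \<Rightarrow> 'e \<Rightarrow> ('a \<Rightarrow> 'e) \<Rightarrow> 'e) \<Rightarrow> 'b \<Rightarrow> 'm \<Rightarrow> ('b \<Rightarrow> 'e) \<Rightarrow> 'e" where
  "cov_along A A' i nabla p u V =
     (let d = chart_at A' (i p) in
        dir_deriv A (\<lambda>q. chart_coords A' d (i q) (V q)) p u
        + (\<Sum>b\<in>Basis. (V p \<bullet> b) *\<^sub>R nabla (i p) (differential A A' i p u) (coord_field A' d b)))"

section \<open>Semi-Riemannian and bronze structures\<close>

definition nondegenerate_on :: "('e::real_vector \<Rightarrow> 'e \<Rightarrow> real) \<Rightarrow> 'e set \<Rightarrow> bool" where
  "nondegenerate_on b V \<longleftrightarrow> (\<forall>u\<in>V. (\<forall>v\<in>V. b u v = 0) \<longrightarrow> u = 0)"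

definition form_index :: "('e::euclidean_space \<Rightarrow> 'e \<Rightarrow> real) \<Rightarrow> nat" where
  "form_index b = Max {dim V | V. subspace V \<and> (\<forall>v\<in>V. v \<noteq> 0 \<longrightarrow> b v v < 0)}"

definition semi_riemannian_metric ::
  "('a::topological_space, 'e::euclidean_space) chart set \<Rightarrow> nat \<Rightarrow> ('a \<Rightarrow> 'e \<Rightarrow> 'e \<Rightarrow> real) \<Rightarrow> bool" where
  "semi_riemannian_metric A k g \<longleftrightarrow>
     (\<forall>p. bilinear (g p) \<and> (\<forall>u v. g p u v = g p v u) \<and> nondegenerate_on (g p) UNIV \<and>
          form_index (g p) = k) \<and>
     (\<forall>U X Y. open U \<longrightarrow> smooth_field A U X \<longrightarrow> smooth_field A U Y \<longrightarrow>
        smooth_fun_on A U (\<lambda>p. g p (X p) (Y p)))"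

definition smooth_endomorphism_field ::
  "('a::topological_space, 'e::euclidean_space) chart set \<Rightarrow> ('a \<Rightarrow> 'e \<Rightarrow> 'e) \<Rightarrow> bool" where
  "smooth_endomorphism_field A J \<longleftrightarrow>
     (\<forall>p. linear (J p)) \<and>
     (\<forall>U X. open U \<longrightarrow> smooth_field A U X \<longrightarrow> smooth_field A U (\<lambda>p. J p (X p)))"

definition bronze_structure ::
  "('a::topological_space, 'e::euclidean_space) chart set \<Rightarrow> ('a \<Rightarrow> 'e \<Rightarrow> 'e \<Rightarrow> real) \<Rightarrow>
   ('a \<Rightarrow> 'e \<Rightarrow> 'e) \<Rightarrow> bool" where
  "bronze_structure A g J \<longleftrightarrow>
     smooth_endomorphism_field A J \<and>
     (\<forall>p u. J p (J p u) = 3 *\<^sub>R J p u + u) \<and>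
     (\<forall>p u v. g p (J p u) v = g p u (J p v))"

definition levi_civita_connection ::
  "('a::topological_space, 'e::euclidean_space) chart set \<Rightarrow> ('a \<Rightarrow> 'e \<Rightarrow> 'e \<Rightarrow> real) \<Rightarrow>
   ('a \<Rightarrow> 'e \<Rightarrow> ('a \<Rightarrow> 'e) \<Rightarrow> 'e) \<Rightarrow> bool" where
  "levi_civita_connection A g nabla \<longleftrightarrow>
     affine_connection A nabla \<and>
     (\<forall>U X Y. open U \<longrightarrow> smooth_field A U X \<longrightarrow> smooth_field A U Y \<longrightarrow>
        (\<forall>p\<in>U. nabla p (X p) Y - nabla p (Y p) X = lie_bracket A X Y p) \<and>
        (\<forall>p\<in>U. \<forall>u. dir_deriv A (\<lambda>q. g q (X q) (Y q)) p u
                     = g p (nabla p u X) (Y p) + g p (X p) (nabla p u Y)))"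

definition parallel_endomorphism ::
  "('a::topological_space, 'e::euclidean_space) chart set \<Rightarrow> ('a \<Rightarrow> 'e \<Rightarrow> ('a \<Rightarrow> 'e) \<Rightarrow> 'e) \<Rightarrow>
   ('a \<Rightarrow> 'e \<Rightarrow> 'e) \<Rightarrow> bool" where
  "parallel_endomorphism A nabla J \<longleftrightarrow>
     (\<forall>U Y. open U \<longrightarrow> smooth_field A U Y \<longrightarrow>
        (\<forall>p\<in>U. \<forall>u. nabla p u (\<lambda>q. J q (Y q)) = J p (nabla p u Y)))"

definition locally_bronze_manifold ::
  "('a::{t2_space,second_countable_topology}, 'e::euclidean_space) chart set \<Rightarrow> nat \<Rightarrow>
   ('a \<Rightarrow> 'e \<Rightarrow> 'e \<Rightarrow> real) \<Rightarrow> ('a \<Rightarrow> 'e \<Rightarrow> 'e) \<Rightarrow> ('a \<Rightarrow> 'e \<Rightarrow> ('a \<Rightarrow> 'e) \<Rightarrow> 'e) \<Rightarrow> bool" where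
  "locally_bronze_manifold A k g J nabla \<longleftrightarrow>
     smooth_manifold A \<and> semi_riemannian_metric A k g \<and> 1 \<le> k \<and> k \<le> DIM('e) - 1 \<and>
     bronze_structure A g J \<and> levi_civita_connection A g nabla \<and> parallel_endomorphism A nabla J"

definition lm_connection ::
  "('a \<Rightarrow> 'e \<Rightarrow> 'e \<Rightarrow> real) \<Rightarrow> ('a \<Rightarrow> 'e \<Rightarrow> 'e) \<Rightarrow> ('a \<Rightarrow> 'e \<Rightarrow> ('a \<Rightarrow> 'e) \<Rightarrow> 'e) \<Rightarrow>
   ('a \<Rightarrow> real) \<Rightarrow> ('a \<Rightarrow> real) \<Rightarrow> ('a \<Rightarrow> 'e) \<Rightarrow> 'a \<Rightarrow> 'e \<Rightarrow> ('a \<Rightarrow> 'e) \<Rightarrow> 'e::real_vector" where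
  "lm_connection g J nabla l m \<eta> p u Y =
     nabla p u Y + g p (Y p) (\<eta> p) *\<^sub>R (l p *\<^sub>R u + m p *\<^sub>R J p u)"

section \<open>Lightlike submanifolds\<close>

text \<open>The submanifold is the manifold \<open>'b\<close> with the inclusion \<open>i\<close>, an injective immersion. All bundles
  over it are families of subspaces of the ambient tangent spaces at the points \<open>i p\<close>.\<close>

definition immersed_submanifold ::
  "('b::{t2_space,second_countable_topology}, 'm::euclidean_space) chart set \<Rightarrow>
   ('a::{t2_space,second_countable_topology}, 'e::euclidean_space) chart set \<Rightarrow> ('b \<Rightarrow> 'a) \<Rightarrow> bool" where
  "immersed_submanifold A A' i \<longleftrightarrow>
     smooth_manifold A \<and> smooth_manifold A' \<and> smooth_map A A' i \<and> inj i \<and>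
     (\<forall>p. inj (differential A A' i p))"

definition tangent_bundle ::
  "('b, 'm::euclidean_space) chart set \<Rightarrow> ('a, 'e::euclidean_space) chart set \<Rightarrow> ('b \<Rightarrow> 'a) \<Rightarrow>
   'b \<Rightarrow> 'e set" where
  "tangent_bundle A A' i p = range (differential A A' i p)"

definition normal_bundle ::
  "('b, 'm::euclidean_space) chart set \<Rightarrow> ('a, 'e::euclidean_space) chart set \<Rightarrow> ('b \<Rightarrow> 'a) \<Rightarrow>
   ('a \<Rightarrow> 'e \<Rightarrow> 'e \<Rightarrow> real) \<Rightarrow> 'b \<Rightarrow> 'e set" where
  "normal_bundle A A' i g p = {v. \<forall>u\<in>tangent_bundle A A' i p. g (i p) v u = 0}"

definition radical ::
  "('b, 'm::euclidean_space) chart set \<Rightarrow> ('a, 'e::euclidean_space) chart set \<Rightarrow> ('b \<Rightarrow> 'a) \<Rightarrow>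
   ('a \<Rightarrow> 'e \<Rightarrow> 'e \<Rightarrow> real) \<Rightarrow> 'b \<Rightarrow> 'e set" where
  "radical A A' i g p = tangent_bundle A A' i p \<inter> normal_bundle A A' i g p"

definition lightlike_submanifold ::
  "('b::{t2_space,second_countable_topology}, 'm::euclidean_space) chart set \<Rightarrow>
   ('a::{t2_space,second_countable_topology}, 'e::euclidean_space) chart set \<Rightarrow> ('b \<Rightarrow> 'a) \<Rightarrow>
   ('a \<Rightarrow> 'e \<Rightarrow> 'e \<Rightarrow> real) \<Rightarrow> nat \<Rightarrow> bool" where
  "lightlike_submanifold A A' i g r \<longleftrightarrow>
     immersed_submanifold A A' i \<and> 0 < r \<and> smooth_subbundle A A' i r (radical A A' i g)"

text \<open>The sum of sets is the pointwise (Minkowski) sum, which for subspaces is the sum of subspaces.\<close>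

definition orth_direct_sum ::
  "('e::real_vector \<Rightarrow> 'e \<Rightarrow> real) \<Rightarrow> 'e set \<Rightarrow> 'e set \<Rightarrow> 'e set \<Rightarrow> bool" where
  "orth_direct_sum b W U V \<longleftrightarrow> W = U + V \<and> U \<inter> V = {0} \<and> (\<forall>u\<in>U. \<forall>v\<in>V. b u v = 0)"

definition screen_distribution ::
  "('b::topological_space, 'm::euclidean_space) chart set \<Rightarrow> ('a, 'e::euclidean_space) chart set \<Rightarrow>
   ('b \<Rightarrow> 'a) \<Rightarrow> ('a \<Rightarrow> 'e \<Rightarrow> 'e \<Rightarrow> real) \<Rightarrow> ('b \<Rightarrow> 'e set) \<Rightarrow> bool" where
  "screen_distribution A A' i g S \<longleftrightarrow>
     smooth_distribution A A' i S \<and>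
     (\<forall>p. orth_direct_sum (g (i p)) (tangent_bundle A A' i p) (radical A A' i g p) (S p))"

definition screen_transversal_bundle ::
  "('b::topological_space, 'm::euclidean_space) chart set \<Rightarrow> ('a, 'e::euclidean_space) chart set \<Rightarrow>
   ('b \<Rightarrow> 'a) \<Rightarrow> ('a \<Rightarrow> 'e \<Rightarrow> 'e \<Rightarrow> real) \<Rightarrow> ('b \<Rightarrow> 'e set) \<Rightarrow> bool" where
  "screen_transversal_bundle A A' i g T \<longleftrightarrow>
     smooth_distribution A A' i T \<and>
     (\<forall>p. orth_direct_sum (g (i p)) (normal_bundle A A' i g p) (radical A A' i g p) (T p))"

definition lightlike_transversal_bundle ::
  "('b::topological_space, 'm::euclidean_space) chart set \<Rightarrow> ('a, 'e::euclidean_space) chart set \<Rightarrow>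
   ('b \<Rightarrow> 'a) \<Rightarrow> ('a \<Rightarrow> 'e \<Rightarrow> 'e \<Rightarrow> real) \<Rightarrow> nat \<Rightarrow> ('b \<Rightarrow> 'e set) \<Rightarrow> ('b \<Rightarrow> 'e set) \<Rightarrow>
   ('b \<Rightarrow> 'e set) \<Rightarrow> bool" where
  "lightlike_transversal_bundle A A' i g r S T L \<longleftrightarrow>
     (\<forall>p. \<exists>U \<xi> N. open U \<and> p \<in> U \<and>
        (\<forall>j<r. smooth_along A A' i U (\<xi> j) \<and> smooth_along A A' i U (N j)) \<and>
        (\<forall>q\<in>U.
           inj_on (\<lambda>j::nat. \<xi> j q) {..<r} \<and> independent ((\<lambda>j. \<xi> j q) ` {..<r}) \<and>
           span ((\<lambda>j. \<xi> j q) ` {..<r}) = radical A A' i g q \<and>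
           span ((\<lambda>j::nat. N j q) ` {..<r}) = L q \<and>
           (\<forall>j<r. \<forall>k<r. g (i q) (N j q) (\<xi> k q) = (if j = k then 1 else 0)) \<and>
           (\<forall>j<r. \<forall>k<r. g (i q) (N j q) (N k q) = 0) \<and>
           (\<forall>j<r. \<forall>v\<in>S q \<union> T q. g (i q) (N j q) v = 0)))"

text \<open>The component in \<open>U\<close> of a vector \<open>v\<close> with respect to a direct sum of subspaces \<open>U\<close> and \<open>V\<close>.\<close>

definition component :: "'e::real_vector set \<Rightarrow> 'e set \<Rightarrow> 'e \<Rightarrow> 'e" where
  "component U V v = (THE u. u \<in> U \<and> v - u \<in> V)"

text \<open>With \<open>S\<close>, \<open>T\<close>, \<open>L\<close> the screen distribution, the screen transversal bundle and the lightlike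
  transversal bundle, \<open>f_part\<close> and \<open>w_part\<close> are the tangential and transversal parts of \<open>J\<close>.\<close>

definition f_part ::
  "('b, 'm::euclidean_space) chart set \<Rightarrow> ('a, 'e::euclidean_space) chart set \<Rightarrow> ('b \<Rightarrow> 'a) \<Rightarrow>
   ('a \<Rightarrow> 'e \<Rightarrow> 'e) \<Rightarrow> ('b \<Rightarrow> 'e set) \<Rightarrow> ('b \<Rightarrow> 'e set) \<Rightarrow> 'b \<Rightarrow> 'e \<Rightarrow> 'e" where
  "f_part A A' i J T L p v = component (tangent_bundle A A' i p) (L p + T p) (J (i p) v)"

definition w_part ::
  "('b, 'm::euclidean_space) chart set \<Rightarrow> ('a, 'e::euclidean_space) chart set \<Rightarrow> ('b \<Rightarrow> 'a) \<Rightarrow>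
   ('a \<Rightarrow> 'e \<Rightarrow> 'e) \<Rightarrow> ('b \<Rightarrow> 'e set) \<Rightarrow> ('b \<Rightarrow> 'e set) \<Rightarrow> 'b \<Rightarrow> 'e \<Rightarrow> 'e" where
  "w_part A A' i J T L p v = component (L p + T p) (tangent_bundle A A' i p) (J (i p) v)"

definition invariant_part :: "('b \<Rightarrow> 'a) \<Rightarrow> ('a \<Rightarrow> 'e \<Rightarrow> 'e) \<Rightarrow> ('b \<Rightarrow> 'e set) \<Rightarrow> 'b \<Rightarrow> 'e set" where
  "invariant_part i J S p = J (i p) ` S p \<inter> S p"

text \<open>\<open>B'\<close> is determined by the remaining data: it is the orthogonal complement of the
  non-degenerate distribution \<open>invariant_part i J S\<close> in \<open>S\<close>. The non-inclusions are between
  subbundles, so each fails as soon as it fails at one point.\<close>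

definition screen_generic ::
  "('b::topological_space, 'm::euclidean_space) chart set \<Rightarrow> ('a, 'e::euclidean_space) chart set \<Rightarrow>
   ('b \<Rightarrow> 'a) \<Rightarrow> ('a \<Rightarrow> 'e \<Rightarrow> 'e \<Rightarrow> real) \<Rightarrow> ('a \<Rightarrow> 'e \<Rightarrow> 'e) \<Rightarrow> ('b \<Rightarrow> 'e set) \<Rightarrow> ('b \<Rightarrow> 'e set) \<Rightarrow>
   ('b \<Rightarrow> 'e set) \<Rightarrow> ('b \<Rightarrow> 'e set) \<Rightarrow> bool" where
  "screen_generic A A' i g J S T L B' \<longleftrightarrow>
     (\<forall>p. J (i p) ` radical A A' i g p = radical A A' i g p) \<and>
     smooth_distribution A A' i (invariant_part i J S) \<and>
     (\<forall>p. nondegenerate_on (g (i p)) (invariant_part i J S p)) \<and>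
     smooth_distribution A A' i B' \<and>
     (\<forall>p. nondegenerate_on (g (i p)) (B' p)) \<and>
     (\<forall>p. orth_direct_sum (g (i p)) (S p) (invariant_part i J S p) (B' p)) \<and>
     ((\<exists>p. B' p \<noteq> {0}) \<longrightarrow>
        \<not> (\<forall>p. J (i p) ` B' p \<subseteq> S p) \<and> \<not> (\<forall>p. J (i p) ` B' p \<subseteq> T p)) \<and>
     (\<forall>Y\<in>sections A A' i B'.
        (\<lambda>p. f_part A A' i J T L p (Y p)) \<in> sections A A' i B' \<and>
        (\<lambda>p. w_part A A' i J T L p (Y p)) \<in> sections A A' i T)"

text \<open>The objects induced by a connection \<open>\<Omega>\<close> of the ambient manifold; \<open>u\<close> is a tangent vector of the
  submanifold at \<open>p\<close> and \<open>V\<close> a field along \<open>i\<close>: tangential to the submanifold for the first two, a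
  section of \<open>S\<close> for the last two.\<close>

definition induced_connection ::
  "('b, 'm::euclidean_space) chart set \<Rightarrow> ('a, 'e::euclidean_space) chart set \<Rightarrow> ('b \<Rightarrow> 'a) \<Rightarrow>
   ('b \<Rightarrow> 'e set) \<Rightarrow> ('b \<Rightarrow> 'e set) \<Rightarrow> ('a \<Rightarrow> 'e \<Rightarrow> ('a \<Rightarrow> 'e) \<Rightarrow> 'e) \<Rightarrow>
   'b \<Rightarrow> 'm \<Rightarrow> ('b \<Rightarrow> 'e) \<Rightarrow> 'e" where
  "induced_connection A A' i T L \<Omega> p u V =
     component (tangent_bundle A A' i p) (L p + T p) (cov_along A A' i \<Omega> p u V)"

definition screen_second_form ::
  "('b, 'm::euclidean_space) chart set \<Rightarrow> ('a, 'e::euclidean_space) chart set \<Rightarrow> ('b \<Rightarrow> 'a) \<Rightarrow>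
   ('b \<Rightarrow> 'e set) \<Rightarrow> ('b \<Rightarrow> 'e set) \<Rightarrow> ('a \<Rightarrow> 'e \<Rightarrow> ('a \<Rightarrow> 'e) \<Rightarrow> 'e) \<Rightarrow>
   'b \<Rightarrow> 'm \<Rightarrow> ('b \<Rightarrow> 'e) \<Rightarrow> 'e" where
  "screen_second_form A A' i T L \<Omega> p u V =
     component (T p) (tangent_bundle A A' i p + L p) (cov_along A A' i \<Omega> p u V)"

definition screen_connection ::
  "('b, 'm::euclidean_space) chart set \<Rightarrow> ('a, 'e::euclidean_space) chart set \<Rightarrow> ('b \<Rightarrow> 'a) \<Rightarrow>
   ('a \<Rightarrow> 'e \<Rightarrow> 'e \<Rightarrow> real) \<Rightarrow> ('b \<Rightarrow> 'e set) \<Rightarrow> ('b \<Rightarrow> 'e set) \<Rightarrow> ('b \<Rightarrow> 'e set) \<Rightarrow>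
   ('a \<Rightarrow> 'e \<Rightarrow> ('a \<Rightarrow> 'e) \<Rightarrow> 'e) \<Rightarrow> 'b \<Rightarrow> 'm \<Rightarrow> ('b \<Rightarrow> 'e) \<Rightarrow> 'e" where
  "screen_connection A A' i g S T L \<Omega> p u V =
     component (S p) (radical A A' i g p) (induced_connection A A' i T L \<Omega> p u V)"

definition radical_second_form ::
  "('b, 'm::euclidean_space) chart set \<Rightarrow> ('a, 'e::euclidean_space) chart set \<Rightarrow> ('b \<Rightarrow> 'a) \<Rightarrow>
   ('a \<Rightarrow> 'e \<Rightarrow> 'e \<Rightarrow> real) \<Rightarrow> ('b \<Rightarrow> 'e set) \<Rightarrow> ('b \<Rightarrow> 'e set) \<Rightarrow> ('b \<Rightarrow> 'e set) \<Rightarrow>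
   ('a \<Rightarrow> 'e \<Rightarrow> ('a \<Rightarrow> 'e) \<Rightarrow> 'e) \<Rightarrow> 'b \<Rightarrow> 'm \<Rightarrow> ('b \<Rightarrow> 'e) \<Rightarrow> 'e" where
  "radical_second_form A A' i g S T L \<Omega> p u V =
     component (radical A A' i g p) (S p) (induced_connection A A' i T L \<Omega> p u V)"

text \<open>\<open>J\<close> applied to a vector field of the submanifold, as a field along \<open>i\<close>.\<close>

definition J_image ::
  "('b, 'm::euclidean_space) chart set \<Rightarrow> ('a, 'e::euclidean_space) chart set \<Rightarrow> ('b \<Rightarrow> 'a) \<Rightarrow>
   ('a \<Rightarrow> 'e \<Rightarrow> 'e) \<Rightarrow> ('b \<Rightarrow> 'm) \<Rightarrow> 'b \<Rightarrow> 'e" where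
  "J_image A A' i J X p = J (i p) (differential A A' i p (X p))"

end

theory Submission
  imports Defs
begin

text \<open>Torsion-freeness and \<open>\<nabla>J = 0\<close>, both transported to fields along \<open>i\<close>, give for sections
  \<open>X\<close>, \<open>Y\<close> of \<open>B\<^sub>o\<close> that the covariant derivatives \<open>\<Omega>\<^sub>X(JY)\<close> and \<open>\<Omega>\<^sub>Y(JX)\<close> differ by \<open>J[X,Y]\<close> up to a
  section of the \<open>J\<close>-invariant bundle \<open>B\<^sub>o\<close>. Write \<open>[X,Y] = \<rho> + \<beta> + \<beta>'\<close> according to
  \<open>TM = Rad TM + B\<^sub>o + B'\<close>. As \<open>J\<^sup>-\<^sup>1 = J - 3\<close>, condition (i) pairs the radical part \<open>J\<rho>\<close> with
  \<open>J\<^sup>-\<^sup>1N\<close> and so reads \<open>g(\<rho>,N) = 0\<close>, while (ii) pairs \<open>J\<beta>'\<close> with \<open>J\<^sup>-\<^sup>1Z\<close> and reads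
  \<open>g(\<beta>',Z) = 0\<close>. Bump functions extend every vector of \<open>ltr(TM)\<close> and of \<open>B'\<close> to a global
  section, so the conditions on sections are the pointwise ones.\<close>

section \<open>Calculus of smooth maps\<close>

text \<open>A tangent vector is stored by its components in the chart chosen at its own base point,
  so a smooth field may jump as a map and cannot be differentiated as it stands; all calculus is
  done on component functions in one fixed chart. A second obstacle is that \<open>JY\<close> exists
  only along \<open>i\<close>, whereas the Levi-Civita connection and \<open>\<nabla>J = 0\<close>
  are given for ambient fields. Fields along \<open>i\<close> are therefore expanded in ambient
  coordinate fields, and torsion-freeness comes down to two symmetries, that of second derivatives
  and that of Christoffel symbols. The \<open>(l,m)\<close> term adds to the derivative of
  \<open>JY\<close> along \<open>X\<close> only a multiple of \<open>lX + mJX\<close>, a vector of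
  \<open>B\<^sub>o\<close>, invisible to the radical part and to pairings with \<open>B'\<close>.
  The coefficient 3 in (i) and (ii) is that of the bronze identity:
  \<open>g(Ju,Jv) - 3 g(Ju,v) = g(u,v)\<close>. The term with \<open>h\<^sup>s\<close> in (ii)
  accounts for the transversal part of \<open>J\<close> on \<open>B'\<close>:
  \<open>g(J\<beta>',JZ)\<close> is the sum of \<open>g(f\<beta>',fZ)\<close> and
  \<open>g(w\<beta>',JZ)\<close>.\<close>

lemma frechet_derivative_cong_open:
  assumes "open S" "x \<in> S" "\<And>y. y \<in> S \<Longrightarrow> f y = g y"
  shows "frechet_derivative f (at x) = frechet_derivative g (at x)"
proof -
  \<comment> \<open>\<open>frechet_derivative\<close> is a choice among all derivatives, so equal
    sets of candidates give equal choices, even at points where no derivative exists.\<close>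
  have "(f has_derivative D) (at x) \<longleftrightarrow> (g has_derivative D) (at x)" for D
    using has_derivative_transform_within_open[OF _ assms(1,2)] assms(3) by metis
  then show ?thesis
    by (simp add: frechet_derivative_def)
qed

lemma differentiable_cong_open:
  assumes "open S" "x \<in> S" "\<And>y. y \<in> S \<Longrightarrow> f y = g y"
  shows "f differentiable (at x) \<longleftrightarrow> g differentiable (at x)"
  unfolding differentiable_def
  using has_derivative_transform_within_open[OF _ assms(1,2)] assms(3) by metis

lemma Ck_on_cong:
  assumes "open S" "\<And>x. x \<in> S \<Longrightarrow> f x = g x"
  shows "Ck_on k S f \<longleftrightarrow> Ck_on k S g"
  using assms(2)
proof (induction k arbitrary: f g)
  case 0
  then show ?case by (simp cong: continuous_on_cong)
next
  case (Suc k)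
  have "Ck_on k S (\<lambda>x. frechet_derivative f (at x) v) \<longleftrightarrow>
        Ck_on k S (\<lambda>x. frechet_derivative g (at x) v)" for v
    using frechet_derivative_cong_open[OF assms(1) _ Suc.prems] by (intro Suc.IH) simp
  moreover have "(\<forall>x\<in>S. f differentiable (at x)) \<longleftrightarrow> (\<forall>x\<in>S. g differentiable (at x))"
    using differentiable_cong_open[OF assms(1), of _ f g] Suc.prems by blast
  ultimately show ?case by simp
qed

lemma Ck_on_subset: "Ck_on k S f \<Longrightarrow> U \<subseteq> S \<Longrightarrow> Ck_on k U f"
  by (induction k arbitrary: f) (auto intro: continuous_on_subset)

lemma Ck_on_Suc_imp: "Ck_on (Suc k) S f \<Longrightarrow> Ck_on k S f"
proof (induction k arbitrary: f)
  case 0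
  then show ?case
    by (auto intro!: continuous_at_imp_continuous_on differentiable_imp_continuous_within)
qed auto

lemma Ck_on_local:
  assumes "\<And>x. x \<in> S \<Longrightarrow> \<exists>U. open U \<and> x \<in> U \<and> Ck_on k (S \<inter> U) f"
  shows "Ck_on k S f"
  using assms
proof (induction k arbitrary: f)
  case 0
  show ?case
    unfolding Ck_on.simps continuous_on_eq_continuous_within
  proof
    fix x assume "x \<in> S"
    then obtain U where U: "open U" "x \<in> U" "continuous (at x within S \<inter> U) f"
      using 0[of x] by (auto simp: continuous_on_eq_continuous_within)
    moreover have "at x within S \<inter> U = at x within S"
      using U by (intro at_within_nhd[of x U]) auto
    ultimately show "continuous (at x within S) f" by simp
  qed
next
  case (Suc k)
  show ?case
    unfolding Ck_on.simps
  proof (intro conjI ballI allI)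
    show "f differentiable (at x)" if "x \<in> S" for x
      using Suc.prems[OF that] that by auto
    show "Ck_on k S (\<lambda>x. frechet_derivative f (at x) v)" for v
      using Suc.prems by (intro Suc.IH) fastforce
  qed
qed

text \<open>The definition of \<open>Ck_on\<close> differentiates by
  \<open>frechet_derivative\<close>. Here an explicit derivative \<open>F\<close> may be supplied
  instead, which lets the rules for sums, products and compositions run by induction.\<close>

lemma Ck_on_SucI:
  assumes "open S" "\<And>x. x \<in> S \<Longrightarrow> (f has_derivative F x) (at x)" "\<And>v. Ck_on k S (\<lambda>x. F x v)"
  shows "Ck_on (Suc k) S f"
proof -
  have "Ck_on k S (\<lambda>x. frechet_derivative f (at x) v)" for v
    using assms(3)[of v]
    by (rule Ck_on_cong[OF assms(1), THEN iffD1, rotated])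
       (simp add: frechet_derivative_at[OF assms(2), symmetric])
  then show ?thesis
    using assms(2) by (auto simp: differentiable_def)
qed

lemma Ck_on_has_derivative:
  "Ck_on (Suc k) S f \<Longrightarrow> x \<in> S \<Longrightarrow> (f has_derivative frechet_derivative f (at x)) (at x)"
  by (simp add: frechet_derivative_works)

lemma Ck_on_const: "Ck_on k S (\<lambda>x. c)"
  by (induction k arbitrary: c) auto

lemma Ck_on_add:
  assumes "open S" "Ck_on k S f" "Ck_on k S g"
  shows "Ck_on k S (\<lambda>x. f x + g x)"
  using assms(2,3)
proof (induction k arbitrary: f g)
  case 0
  then show ?case by (simp add: continuous_on_add)
next
  case (Suc k)
  show ?case
    using Suc.prems
    by (intro Ck_on_SucI[OF assms(1) has_derivative_add[OF Ck_on_has_derivative[OF Suc.prems(1)]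
            Ck_on_has_derivative[OF Suc.prems(2)]]] Suc.IH) auto
qed

lemma Ck_on_sum:
  assumes "open S" "\<And>i. i \<in> I \<Longrightarrow> Ck_on k S (f i)"
  shows "Ck_on k S (\<lambda>x. \<Sum>i\<in>I. f i x)"
  using assms(2)
  by (induction I rule: infinite_finite_induct) (auto intro: Ck_on_add[OF assms(1)] Ck_on_const)

text \<open>One induction with the product rule serves both scalar multiplication and the inner
  product. Each summand contains an undifferentiated factor, whose order is lowered by
  \<open>Ck_on_Suc_imp\<close>.\<close>

lemma (in bounded_bilinear) Ck_on:
  assumes "open S" "Ck_on k S f" "Ck_on k S g"
  shows "Ck_on k S (\<lambda>x. prod (f x) (g x))"
  using assms(2,3)
proof (induction k arbitrary: f g)
  case 0
  then show ?case by (simp add: continuous_on)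
next
  case (Suc k)
  show ?case
    using Suc.prems Ck_on_Suc_imp[OF Suc.prems(1)] Ck_on_Suc_imp[OF Suc.prems(2)]
    by (intro Ck_on_SucI[OF assms(1) FDERIV[OF Ck_on_has_derivative[OF Suc.prems(1)]
            Ck_on_has_derivative[OF Suc.prems(2)]]] Ck_on_add[OF assms(1)] Suc.IH) auto
qed

lemma (in bounded_linear) Ck_on:
  assumes "open S" "Ck_on k S g"
  shows "Ck_on k S (\<lambda>x. f (g x))"
  using assms(2)
proof (induction k arbitrary: g)
  case 0
  then show ?case by (simp add: continuous_on)
next
  case (Suc k)
  show ?case
    using Suc.prems
    by (intro Ck_on_SucI[OF assms(1) has_derivative[OF Ck_on_has_derivative[OF Suc.prems]]] Suc.IH) auto
qed

lemma linear_euclidean_sum: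
  fixes F :: "'e::euclidean_space \<Rightarrow> 'w::real_vector"
  assumes "linear F"
  shows "F u = (\<Sum>b\<in>Basis. (u \<bullet> b) *\<^sub>R F b)"
proof -
  have "F u = F (\<Sum>b\<in>Basis. (u \<bullet> b) *\<^sub>R b)"
    by (simp add: euclidean_representation)
  also have "\<dots> = (\<Sum>b\<in>Basis. (u \<bullet> b) *\<^sub>R F b)"
    by (simp add: linear_sum[OF assms] linear_cmul[OF assms])
  finally show ?thesis .
qed

text \<open>The chain rule is written with partial derivatives of \<open>f\<close> along the basis
  of the intermediate space: each of them, composed with \<open>g\<close>, is again of the form
  covered by the induction hypothesis.\<close>

lemma Ck_on_compose:
  fixes g :: "'v::real_normed_vector \<Rightarrow> 'e::euclidean_space"
  assumes "open S" "open U" "g ` S \<subseteq> U" "Ck_on k U f" "Ck_on k S g"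
  shows "Ck_on k S (f \<circ> g)"
  using assms(4,5)
proof (induction k arbitrary: f)
  case 0
  then show ?case using assms(3) by (auto intro: continuous_on_compose continuous_on_subset simp del: o_apply)
next
  case (Suc k)
  let ?D = "\<lambda>x v. \<Sum>b\<in>Basis. (frechet_derivative g (at x) v \<bullet> b) *\<^sub>R
    ((\<lambda>y. frechet_derivative f (at y) b) \<circ> g) x"
  have diff: "f differentiable (at (g x))" "g differentiable (at x)" if "x \<in> S" for x
    using Suc.prems assms(3) that by auto
  show ?case
  proof (rule Ck_on_SucI[OF assms(1)])
    show "((f \<circ> g) has_derivative ?D x) (at x)" if "x \<in> S" for x
      using diff_chain_at[OF diff(2)[OF that, unfolded frechet_derivative_works]
          diff(1)[OF that, unfolded frechet_derivative_works]]
      by (rule has_derivative_eq_rhs)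
         (auto simp: fun_eq_iff intro!: linear_euclidean_sum linear_frechet_derivative diff that)
    show "Ck_on k S (\<lambda>x. ?D x v)" for v
      using Suc.prems Ck_on_Suc_imp[OF Suc.prems(2)]
      by (intro Ck_on_sum bounded_bilinear.Ck_on[OF bounded_bilinear_scaleR]
          bounded_linear.Ck_on[OF bounded_linear_inner_left] Suc.IH assms) auto
  qed
qed

lemma smooth_on_cong:
  "open S \<Longrightarrow> (\<And>x. x \<in> S \<Longrightarrow> f x = g x) \<Longrightarrow> smooth_on S f \<longleftrightarrow> smooth_on S g"
  using Ck_on_cong unfolding smooth_on_def by blast

lemma smooth_on_subset: "smooth_on S f \<Longrightarrow> U \<subseteq> S \<Longrightarrow> smooth_on U f"
  using Ck_on_subset unfolding smooth_on_def by blast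

lemma smooth_on_local:
  assumes "\<And>x. x \<in> S \<Longrightarrow> \<exists>U. open U \<and> x \<in> U \<and> smooth_on (S \<inter> U) f"
  shows "smooth_on S f"
  using Ck_on_local[of S _ f] assms unfolding smooth_on_def by metis

lemma smooth_on_const: "smooth_on S (\<lambda>x. c)"
  by (simp add: smooth_on_def Ck_on_const)

lemma smooth_on_linear: "bounded_linear f \<Longrightarrow> smooth_on S f"
proof -
  assume f: "bounded_linear f"
  have "Ck_on k S f" for k
    using f by (cases k) (auto intro: linear_continuous_on bounded_linear_imp_differentiable
        simp: Ck_on_const frechet_derivative_at[OF bounded_linear_imp_has_derivative[OF f], symmetric])
  then show ?thesis by (simp add: smooth_on_def)
qed

lemma smooth_on_add:
  "open S \<Longrightarrow> smooth_on S f \<Longrightarrow> smooth_on S g \<Longrightarrow> smooth_on S (\<lambda>x. f x + g x)"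
  by (simp add: smooth_on_def Ck_on_add)

lemma smooth_on_sum:
  "open S \<Longrightarrow> (\<And>i. i \<in> I \<Longrightarrow> smooth_on S (f i)) \<Longrightarrow> smooth_on S (\<lambda>x. \<Sum>i\<in>I. f i x)"
  by (simp add: smooth_on_def Ck_on_sum)

lemma smooth_on_scaleR:
  "open S \<Longrightarrow> smooth_on S f \<Longrightarrow> smooth_on S g \<Longrightarrow> smooth_on S (\<lambda>x. f x *\<^sub>R g x)"
  by (simp add: smooth_on_def bounded_bilinear.Ck_on[OF bounded_bilinear_scaleR])

lemma smooth_on_inner:
  "open S \<Longrightarrow> smooth_on S f \<Longrightarrow> smooth_on S g \<Longrightarrow> smooth_on S (\<lambda>x. f x \<bullet> g x)"
  by (simp add: smooth_on_def bounded_bilinear.Ck_on[OF bounded_bilinear_inner])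

lemma smooth_on_diff:
  assumes "open S" "smooth_on S f" "smooth_on S g"
  shows "smooth_on S (\<lambda>x. f x - g x)"
  using smooth_on_add[OF assms(1,2) smooth_on_scaleR[OF assms(1) smooth_on_const assms(3)], of "-1"]
  by simp

lemma smooth_on_compose:
  fixes g :: "'v::real_normed_vector \<Rightarrow> 'e::euclidean_space"
  assumes "open S" "open U" "g ` S \<subseteq> U" "smooth_on U f" "smooth_on S g"
  shows "smooth_on S (f \<circ> g)"
  using assms by (simp add: smooth_on_def Ck_on_compose)

lemma smooth_on_differentiable: "smooth_on S f \<Longrightarrow> x \<in> S \<Longrightarrow> f differentiable (at x)"
  unfolding smooth_on_def using Ck_on.simps(2) by blast

lemma smooth_on_has_derivative:
  "smooth_on S f \<Longrightarrow> x \<in> S \<Longrightarrow> (f has_derivative frechet_derivative f (at x)) (at x)"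
  using smooth_on_differentiable frechet_derivative_works by blast

lemma smooth_on_derivative: "smooth_on S f \<Longrightarrow> smooth_on S (\<lambda>x. frechet_derivative f (at x) v)"
  unfolding smooth_on_def using Ck_on.simps(2) by blast

lemma smooth_on_derivative_field:
  fixes f :: "'e::euclidean_space \<Rightarrow> 'w::real_normed_vector"
  assumes "open S" "smooth_on S f" "smooth_on S y"
  shows "smooth_on S (\<lambda>x. frechet_derivative f (at x) (y x))"
proof -
  have "smooth_on S (\<lambda>x. \<Sum>b\<in>Basis. (y x \<bullet> b) *\<^sub>R frechet_derivative f (at x) b)"
    using assms by (intro smooth_on_sum smooth_on_scaleR smooth_on_inner smooth_on_const smooth_on_derivative)
  then show ?thesis
    by (rule smooth_on_cong[OF assms(1), THEN iffD1, rotated])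
       (rule linear_euclidean_sum[symmetric, OF linear_frechet_derivative[OF smooth_on_differentiable[OF assms(2)]]])
qed

lemma smooth_on_continuous: "smooth_on S f \<Longrightarrow> continuous_on S f"
  unfolding smooth_on_def using Ck_on.simps(1) by blast

section \<open>Symmetry of second derivatives\<close>

lemma mixed_difference_mean_value:
  fixes f :: "'v::real_normed_vector \<Rightarrow> real"
  assumes t: "0 < t"
    and sub: "\<And>a b. 0 \<le> a \<Longrightarrow> a \<le> t \<Longrightarrow> 0 \<le> b \<Longrightarrow> b \<le> t \<Longrightarrow> x + a *\<^sub>R v + b *\<^sub>R w \<in> S"
    and f: "smooth_on S f"
  obtains a b where "0 < a" "a < t" "0 < b" "b < t"
    "f (x + t *\<^sub>R v + t *\<^sub>R w) - f (x + t *\<^sub>R v) - f (x + t *\<^sub>R w) + f x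
      = t * t * frechet_derivative (\<lambda>y. frechet_derivative f (at y) v) (at (x + a *\<^sub>R v + b *\<^sub>R w)) w"
proof -
  let ?fv = "\<lambda>y. frechet_derivative f (at y) v"
  have line: "((\<lambda>a. h (y + a *\<^sub>R u)) has_real_derivative frechet_derivative h (at (y + a *\<^sub>R u)) u) (at a)"
    if h: "smooth_on S h" "y + a *\<^sub>R u \<in> S" for y u a and h :: "'v \<Rightarrow> real"
  proof -
    have "((\<lambda>a. y + a *\<^sub>R u) has_derivative (\<lambda>s. s *\<^sub>R u)) (at a)"
      by (auto intro!: derivative_eq_intros)
    from diff_chain_at[OF this smooth_on_has_derivative[OF h]]
    have "((\<lambda>a. h (y + a *\<^sub>R u)) has_derivative
        (\<lambda>s. frechet_derivative h (at (y + a *\<^sub>R u)) (s *\<^sub>R u))) (at a)"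
      by (simp add: o_def)
    then show ?thesis
      using linear_cmul[OF linear_frechet_derivative[OF smooth_on_differentiable[OF h]]]
      by (simp add: has_field_derivative_def mult_commute_abs)
  qed
  \<comment> \<open>The second difference is the increment over \<open>[0,t]\<close> of the first
    difference in direction \<open>w\<close>, seen as a function of \<open>a\<close>. After one mean
    value step in \<open>a\<close>, the derivative in direction \<open>v\<close> is treated the same
    way in \<open>b\<close>.\<close>
  have "((\<lambda>a. f (x + a *\<^sub>R v + t *\<^sub>R w) - f (x + a *\<^sub>R v)) has_real_derivative
       ?fv (x + a *\<^sub>R v + t *\<^sub>R w) - ?fv (x + a *\<^sub>R v)) (at a)" if "0 \<le> a" "a \<le> t" for a
  proof (rule DERIV_diff)
    show "((\<lambda>a. f (x + a *\<^sub>R v + t *\<^sub>R w)) has_real_derivative ?fv (x + a *\<^sub>R v + t *\<^sub>R w)) (at a)"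
      using line[OF f, of "x + t *\<^sub>R w" a v] sub[OF that, of t] t by (simp add: add_ac)
    show "((\<lambda>a. f (x + a *\<^sub>R v)) has_real_derivative ?fv (x + a *\<^sub>R v)) (at a)"
      using line[OF f, of x a v] sub[OF that, of 0] t by simp
  qed
  from MVT2[OF t this] obtain a where a: "0 < a" "a < t"
    "f (x + t *\<^sub>R v + t *\<^sub>R w) - f (x + t *\<^sub>R v) - (f (x + t *\<^sub>R w) - f x)
      = t * (?fv (x + a *\<^sub>R v + t *\<^sub>R w) - ?fv (x + a *\<^sub>R v))"
    by auto
  have "((\<lambda>b. ?fv (x + a *\<^sub>R v + b *\<^sub>R w)) has_real_derivative
      frechet_derivative ?fv (at (x + a *\<^sub>R v + b *\<^sub>R w)) w) (at b)" if "0 \<le> b" "b \<le> t" for b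
    using line[OF smooth_on_derivative[OF f], of "x + a *\<^sub>R v" b w] sub[of a b] a that by simp
  from MVT2[OF t this] obtain b where "0 < b" "b < t"
    "?fv (x + a *\<^sub>R v + t *\<^sub>R w) - ?fv (x + a *\<^sub>R v)
      = t * frechet_derivative ?fv (at (x + a *\<^sub>R v + b *\<^sub>R w)) w"
    by auto
  with a show ?thesis by (intro that[of a b]) simp_all
qed

text \<open>The second difference over a parallelogram does not change when \<open>v\<close> and
  \<open>w\<close> are exchanged, and it is \<open>t * t\<close> times a nearby value of either
  mixed derivative. Continuity of both at \<open>x\<close> does the rest.\<close>

lemma symmetric_second_derivative_real:
  fixes f :: "'v::real_normed_vector \<Rightarrow> real"
  assumes S: "open S" "x \<in> S" and f: "smooth_on S f"
  shows "frechet_derivative (\<lambda>y. frechet_derivative f (at y) v) (at x) w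
       = frechet_derivative (\<lambda>y. frechet_derivative f (at y) w) (at x) v"
proof -
  let ?H = "\<lambda>v w y. frechet_derivative (\<lambda>y. frechet_derivative f (at y) v) (at y) w"
  have cont: "isCont (?H v w) x" for v w
    using smooth_on_continuous[OF smooth_on_derivative[OF smooth_on_derivative[OF f]]] S
    by (simp add: continuous_on_eq_continuous_at)
  have "\<bar>?H v w x - ?H w v x\<bar> < e" if e: "e > 0" for e
  proof -
    obtain d1 where d1: "d1 > 0" "\<And>y. dist y x < d1 \<Longrightarrow> \<bar>?H v w y - ?H v w x\<bar> < e/2"
      using cont[of v w] e unfolding continuous_at_eps_delta dist_real_def by (meson half_gt_zero)
    obtain d2 where d2: "d2 > 0" "\<And>y. dist y x < d2 \<Longrightarrow> \<bar>?H w v y - ?H w v x\<bar> < e/2"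
      using cont[of w v] e unfolding continuous_at_eps_delta dist_real_def by (meson half_gt_zero)
    obtain d3 where d3: "d3 > 0" "ball x d3 \<subseteq> S"
      using S open_contains_ball by blast
    define d where "d = min d1 (min d2 d3)"
    \<comment> \<open>The summand 1 keeps \<open>n\<close> positive when \<open>v\<close> and
      \<open>w\<close> vanish; the factor 1/2 in \<open>t\<close> keeps the parallelogram strictly
      within distance \<open>d\<close> of \<open>x\<close>.\<close>
    define n where "n = norm v + norm w + 1"
    define t where "t = d / n / 2"
    have pos: "n > 0" by (simp add: n_def add_nonneg_pos)
    have dpos: "d > 0" using d1 d2 d3 by (simp add: d_def)
    have t: "t > 0" using pos dpos by (simp add: t_def)
    have tb: "t * (norm v + norm w) < d"
    proof -
      have "t * (norm v + norm w) \<le> t * n" using t by (simp add: n_def)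
      also have "\<dots> = d / 2" using pos by (simp add: t_def)
      finally show ?thesis using dpos by simp
    qed
    have near: "dist (x + a *\<^sub>R v + b *\<^sub>R w) x < d" if "0 \<le> a" "a \<le> t" "0 \<le> b" "b \<le> t" for a b
    proof -
      have "dist (x + a *\<^sub>R v + b *\<^sub>R w) x = norm (a *\<^sub>R v + b *\<^sub>R w)"
        by (simp add: dist_norm add.assoc)
      also have "\<dots> \<le> norm (a *\<^sub>R v) + norm (b *\<^sub>R w)" by (rule norm_triangle_ineq)
      also have "\<dots> \<le> t * (norm v + norm w)"
        using that by (auto simp: algebra_simps intro!: add_mono mult_right_mono)
      finally show ?thesis using tb by simp
    qed
    have near': "dist (x + b *\<^sub>R w + a *\<^sub>R v) x < d" if "0 \<le> a" "a \<le> t" "0 \<le> b" "b \<le> t" for a b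
      using near[OF that] by (simp add: add_ac)
    have inS: "y \<in> S" if "dist y x < d" for y
      using that d3 by (auto simp: d_def dist_commute)
    obtain a b where ab: "0 < a" "a < t" "0 < b" "b < t"
      "f (x + t *\<^sub>R v + t *\<^sub>R w) - f (x + t *\<^sub>R v) - f (x + t *\<^sub>R w) + f x
        = t * t * ?H v w (x + a *\<^sub>R v + b *\<^sub>R w)"
      using mixed_difference_mean_value[OF t inS[OF near] f] by blast
    obtain a' b' where ab': "0 < b'" "b' < t" "0 < a'" "a' < t"
      "f (x + t *\<^sub>R w + t *\<^sub>R v) - f (x + t *\<^sub>R w) - f (x + t *\<^sub>R v) + f x
        = t * t * ?H w v (x + b' *\<^sub>R w + a' *\<^sub>R v)"
      by (rule mixed_difference_mean_value[OF t _ f, of x w v]) (auto intro!: inS near')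
    have swap: "f (x + t *\<^sub>R w + t *\<^sub>R v) = f (x + t *\<^sub>R v + t *\<^sub>R w)"
      by (simp add: add_ac)
    have "t * t * ?H v w (x + a *\<^sub>R v + b *\<^sub>R w) = t * t * ?H w v (x + b' *\<^sub>R w + a' *\<^sub>R v)"
      using ab(5) ab'(5)[unfolded swap] by linarith
    then have eq: "?H v w (x + a *\<^sub>R v + b *\<^sub>R w) = ?H w v (x + b' *\<^sub>R w + a' *\<^sub>R v)"
      using t by simp
    have "dist (x + a *\<^sub>R v + b *\<^sub>R w) x < d1" "dist (x + b' *\<^sub>R w + a' *\<^sub>R v) x < d2"
      using near[of a b] near'[of a' b'] ab ab' by (auto simp: d_def)
    from d1(2)[OF this(1)] d2(2)[OF this(2)] eq show ?thesis
      by linarith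
  qed
  \<comment> \<open>A nonzero difference could serve as its own \<open>e\<close> and would be
    smaller than itself.\<close>
  from this[of "\<bar>?H v w x - ?H w v x\<bar>"] show ?thesis by fastforce
qed

lemma frechet_derivative_inner_left:
  assumes "f differentiable (at x)"
  shows "frechet_derivative (\<lambda>y. f y \<bullet> b) (at x) v = frechet_derivative f (at x) v \<bullet> b"
  using frechet_derivative_at[OF has_derivative_inner_left[OF assms[unfolded frechet_derivative_works]]]
  by metis

lemma symmetric_second_derivative:
  fixes f :: "'v::real_normed_vector \<Rightarrow> 'w::euclidean_space"
  assumes S: "open S" "x \<in> S" and f: "smooth_on S f"
  shows "frechet_derivative (\<lambda>y. frechet_derivative f (at y) v) (at x) w
       = frechet_derivative (\<lambda>y. frechet_derivative f (at y) w) (at x) v"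
proof (rule euclidean_eqI)
  fix b :: 'w
  have fb: "smooth_on S (\<lambda>y. f y \<bullet> b)"
    by (intro smooth_on_inner S f smooth_on_const)
  have "frechet_derivative (\<lambda>y. frechet_derivative (\<lambda>y. f y \<bullet> b) (at y) v) (at x) w
      = frechet_derivative (\<lambda>y. frechet_derivative f (at y) v) (at x) w \<bullet> b" for v w
  proof -
    have "frechet_derivative (\<lambda>y. frechet_derivative (\<lambda>y. f y \<bullet> b) (at y) v) (at x)
        = frechet_derivative (\<lambda>y. frechet_derivative f (at y) v \<bullet> b) (at x)"
      by (rule frechet_derivative_cong_open[OF S])
         (simp add: frechet_derivative_inner_left smooth_on_differentiable[OF f])
    then show ?thesis
      using smooth_on_differentiable[OF smooth_on_derivative[OF f] S(2)]
      by (simp add: frechet_derivative_inner_left)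
  qed
  then show "frechet_derivative (\<lambda>y. frechet_derivative f (at y) v) (at x) w \<bullet> b
       = frechet_derivative (\<lambda>y. frechet_derivative f (at y) w) (at x) v \<bullet> b"
    using symmetric_second_derivative_real[OF S fb] by metis
qed

text \<open>Expanding \<open>y\<close> in the basis makes the map a finite sum of products. The
  second summand of the result is the second derivative of \<open>f\<close> with one direction
  frozen at \<open>y x\<close>.\<close>

lemma has_derivative_derivative_field:
  fixes f :: "'e::euclidean_space \<Rightarrow> 'w::real_normed_vector"
  assumes S: "open S" "x \<in> S" and f: "smooth_on S f" and y: "smooth_on S y"
  shows "((\<lambda>z. frechet_derivative f (at z) (y z)) has_derivative
    (\<lambda>v. frechet_derivative f (at x) (frechet_derivative y (at x) v)
       + (\<Sum>b\<in>Basis. (y x \<bullet> b) *\<^sub>R frechet_derivative (\<lambda>z. frechet_derivative f (at z) b) (at x) v))) (at x)"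
proof -
  have lin: "linear (frechet_derivative f (at z))" if "z \<in> S" for z
    using linear_frechet_derivative smooth_on_differentiable[OF f that] .
  have "((\<lambda>z. \<Sum>b\<in>Basis. (y z \<bullet> b) *\<^sub>R frechet_derivative f (at z) b) has_derivative
    (\<lambda>v. \<Sum>b\<in>Basis. (y x \<bullet> b) *\<^sub>R frechet_derivative (\<lambda>z. frechet_derivative f (at z) b) (at x) v
       + (frechet_derivative y (at x) v \<bullet> b) *\<^sub>R frechet_derivative f (at x) b)) (at x)"
    using S by (intro has_derivative_sum has_derivative_scaleR has_derivative_inner_left
        smooth_on_has_derivative[OF y] smooth_on_has_derivative[OF smooth_on_derivative[OF f]])
  then show ?thesis
    by (rule has_derivative_transform_within_open[OF _ S, THEN has_derivative_eq_rhs])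
       (auto simp: sum.distrib linear_euclidean_sum[OF lin, symmetric] S add.commute)
qed

text \<open>The second derivatives of \<open>\<tau>\<close> cancel because they are symmetric.\<close>

lemma pushforward_bracket:
  fixes \<tau> :: "'m::euclidean_space \<Rightarrow> 'e::euclidean_space"
  assumes S: "open S" "z \<in> S" and \<tau>: "smooth_on S \<tau>" and x: "smooth_on S x" and y: "smooth_on S y"
  shows "frechet_derivative (\<lambda>z. frechet_derivative \<tau> (at z) (y z)) (at z) (x z)
       - frechet_derivative (\<lambda>z. frechet_derivative \<tau> (at z) (x z)) (at z) (y z)
       = frechet_derivative \<tau> (at z)
           (frechet_derivative y (at z) (x z) - frechet_derivative x (at z) (y z))"
proof -
  let ?H = "\<lambda>b v. frechet_derivative (\<lambda>z. frechet_derivative \<tau> (at z) b) (at z) v"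
  have lin: "linear (?H b)" for b
    using linear_frechet_derivative smooth_on_differentiable[OF smooth_on_derivative[OF \<tau>] S(2)] .
  have H: "(\<Sum>b\<in>Basis. (u \<bullet> b) *\<^sub>R ?H b v) = ?H v u" for u v
    using symmetric_second_derivative[OF S \<tau>] linear_euclidean_sum[OF lin, of v u] by simp
  have lin0: "linear (frechet_derivative \<tau> (at z))"
    using linear_frechet_derivative smooth_on_differentiable[OF \<tau> S(2)] .
  show ?thesis
    unfolding frechet_derivative_at[OF has_derivative_derivative_field[OF S \<tau> x], symmetric]
      frechet_derivative_at[OF has_derivative_derivative_field[OF S \<tau> y], symmetric] H
    using symmetric_second_derivative[OF S \<tau>, of "x z" "y z"] by (simp add: linear_diff[OF lin0])
qed

section \<open>Charts and tangent vectors\<close>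

locale manifold =
  fixes A :: "('a::{t2_space,second_countable_topology}, 'e::euclidean_space) chart set"
  assumes manifold: "smooth_manifold A"
begin

lemma open_chart: "c \<in> A \<Longrightarrow> open (fst c)"
  using manifold by (auto simp: smooth_manifold_def)

lemma homeo_chart: "c \<in> A \<Longrightarrow> homeomorphism (fst c) (snd c ` fst c) (snd c) (chart_inv c)"
  using manifold by (auto simp: smooth_manifold_def)

lemma chart_inv_left [simp]: "c \<in> A \<Longrightarrow> p \<in> fst c \<Longrightarrow> chart_inv c (snd c p) = p"
  using homeo_chart by (simp add: homeomorphism_def)

lemma chart_inv_left_pair [simp]: "(U, \<phi>) \<in> A \<Longrightarrow> p \<in> U \<Longrightarrow> chart_inv (U, \<phi>) (\<phi> p) = p"
  using chart_inv_left[of "(U, \<phi>)"] by simp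

lemma chart_inv_right: "c \<in> A \<Longrightarrow> z \<in> snd c ` fst c \<Longrightarrow> snd c (chart_inv c z) = z"
  using homeo_chart by (auto simp: homeomorphism_def)

lemma open_chart_image:
  assumes "c \<in> A" "open U"
  shows "open (snd c ` (U \<inter> fst c))"
proof -
  have "openin (top_of_set (snd c ` fst c)) (snd c ` (U \<inter> fst c))"
    using homeomorphism_imp_open_map[OF homeo_chart[OF assms(1)]] openin_open_Int[OF assms(2)]
    by (simp add: Int_commute[of U])
  moreover have "open (snd c ` fst c)"
    using manifold assms(1) by (auto simp: smooth_manifold_def)
  ultimately show ?thesis
    using openin_open_trans by blast
qed

lemma open_chart_image': "c \<in> A \<Longrightarrow> open U \<Longrightarrow> U \<subseteq> fst c \<Longrightarrow> open (snd c ` U)"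
  using open_chart_image[of c U] by (simp add: Int_absorb2)

lemma chart_at_in [simp]: "chart_at A p \<in> A"
  and chart_at_mem [simp]: "p \<in> fst (chart_at A p)"
proof -
  have "\<exists>c. c \<in> A \<and> p \<in> fst c"
    using manifold unfolding smooth_manifold_def by (metis UNIV_I UN_E)
  from someI_ex[OF this] show "chart_at A p \<in> A" "p \<in> fst (chart_at A p)"
    by (auto simp: chart_at_def)
qed

lemma smooth_transition:
  "c \<in> A \<Longrightarrow> d \<in> A \<Longrightarrow> smooth_on (snd c ` (fst c \<inter> fst d)) (snd d \<circ> chart_inv c)"
  using manifold by (auto simp: smooth_manifold_def)

lemma transition_has_derivative:
  assumes "c \<in> A" "d \<in> A" "p \<in> fst c" "p \<in> fst d"
  shows "((snd d \<circ> chart_inv c) has_derivative transition c d p) (at (snd c p))"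
  using smooth_on_has_derivative[OF smooth_transition[OF assms(1,2)], of "snd c p"] assms(3,4)
  unfolding transition_def[abs_def] by (simp add: eta_contract_eq)

lemma linear_transition:
  "c \<in> A \<Longrightarrow> d \<in> A \<Longrightarrow> p \<in> fst c \<Longrightarrow> p \<in> fst d \<Longrightarrow> linear (transition c d p)"
  using has_derivative_linear transition_has_derivative by blast

lemma linear_chart_coords: "c \<in> A \<Longrightarrow> p \<in> fst c \<Longrightarrow> linear (chart_coords A c p)"
  using linear_transition[of "chart_at A p" c p] by (simp add: chart_coords_def[abs_def] eta_contract_eq)

lemma has_derivative_change_chart:
  assumes c: "c \<in> A" "p \<in> fst c" and e: "e \<in> A" "p \<in> fst e"
    and F: "(F \<circ> chart_inv c has_derivative D) (at (snd c p))"
  shows "(F \<circ> chart_inv e has_derivative D \<circ> transition e c p) (at (snd e p))"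
proof -
  have "((F \<circ> chart_inv c) \<circ> (snd c \<circ> chart_inv e) has_derivative D \<circ> transition e c p) (at (snd e p))"
    using c e F by (intro diff_chain_at transition_has_derivative) auto
  then show ?thesis
    by (rule has_derivative_transform_within_open[OF _ open_chart_image[OF e(1) open_chart[OF c(1)]]])
       (use c e in auto)
qed

lemma transition_self [simp]:
  assumes "c \<in> A" "p \<in> fst c"
  shows "transition c c p = (\<lambda>v. v)"
proof -
  have "((\<lambda>z. z) has_derivative transition c c p) (at (snd c p))"
    by (rule has_derivative_transform_within_open[OF transition_has_derivative
          open_chart_image[OF assms(1) open_chart[OF assms(1)]]])
       (use assms in auto)
  then show ?thesis
    using has_derivative_ident has_derivative_unique by blast
qed

text \<open>The cocycle rule: both sides are derivatives at \<open>snd c p\<close> of the same map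
  \<open>snd e \<circ> chart_inv c\<close>, so uniqueness of the derivative suffices.\<close>

lemma transition_trans:
  assumes "c \<in> A" "d \<in> A" "e \<in> A" "p \<in> fst c" "p \<in> fst d" "p \<in> fst e"
  shows "transition d e p (transition c d p v) = transition c e p v"
  using has_derivative_unique[OF transition_has_derivative
      has_derivative_change_chart[OF _ _ _ _ transition_has_derivative], of c e p d] assms
  by (simp add: fun_eq_iff)

lemma chart_coords_chart_at [simp]: "chart_coords A (chart_at A p) p v = v"
  by (simp add: chart_coords_def)

lemma transition_chart_coords:
  "c \<in> A \<Longrightarrow> d \<in> A \<Longrightarrow> p \<in> fst c \<Longrightarrow> p \<in> fst d \<Longrightarrow>
    transition c d p (chart_coords A c p v) = chart_coords A d p v"
  by (simp add: chart_coords_def transition_trans)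

lemma chart_coords_coord_field:
  "c \<in> A \<Longrightarrow> d \<in> A \<Longrightarrow> p \<in> fst c \<Longrightarrow> p \<in> fst d \<Longrightarrow>
    chart_coords A d p (coord_field A c b p) = transition c d p b"
  by (simp add: chart_coords_def coord_field_def transition_trans)

lemma coord_field_chart_coords:
  "c \<in> A \<Longrightarrow> p \<in> fst c \<Longrightarrow> coord_field A c (chart_coords A c p v) p = v"
  by (simp add: chart_coords_def coord_field_def transition_trans)

lemma coord_field_chart_at [simp]: "coord_field A (chart_at A p) b p = b"
  by (simp add: coord_field_def)

lemma linear_coord_field: "c \<in> A \<Longrightarrow> p \<in> fst c \<Longrightarrow> linear (\<lambda>b. coord_field A c b p)"
  using linear_transition[of c "chart_at A p" p] by (simp add: coord_field_def)

section \<open>Smooth functions and fields\<close>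

lemma smooth_fun_onD:
  "smooth_fun_on A U f \<Longrightarrow> c \<in> A \<Longrightarrow> smooth_on (snd c ` (U \<inter> fst c)) (f \<circ> chart_inv c)"
  by (simp add: smooth_fun_on_def)

lemma smooth_fun_on_subset: "smooth_fun_on A U f \<Longrightarrow> V \<subseteq> U \<Longrightarrow> smooth_fun_on A V f"
  unfolding smooth_fun_on_def by (meson Int_mono image_mono order_refl smooth_on_subset)

lemma smooth_fun_on_cong:
  assumes "open U" "\<And>p. p \<in> U \<Longrightarrow> f p = g p"
  shows "smooth_fun_on A U f \<longleftrightarrow> smooth_fun_on A U g"
  unfolding smooth_fun_on_def
  by (intro ball_cong refl smooth_on_cong open_chart_image assms(1)) (use assms(2) in auto)

lemma smooth_fun_on_local:
  assumes "\<And>p. p \<in> U \<Longrightarrow> \<exists>V. open V \<and> p \<in> V \<and> smooth_fun_on A (U \<inter> V) f"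
  shows "smooth_fun_on A U f"
  unfolding smooth_fun_on_def
proof (intro ballI smooth_on_local)
  fix c z assume c: "c \<in> A" and z: "z \<in> snd c ` (U \<inter> fst c)"
  from z obtain p where p: "z = snd c p" "p \<in> U" "p \<in> fst c" by auto
  from assms[OF p(2)] obtain V where V: "open V" "p \<in> V" "smooth_fun_on A (U \<inter> V) f" by auto
  have "smooth_on (snd c ` (U \<inter> fst c) \<inter> snd c ` (V \<inter> fst c)) (f \<circ> chart_inv c)"
    by (rule smooth_on_subset[OF smooth_fun_onD[OF V(3) c]])
       (use c in \<open>auto, metis IntI chart_inv_left imageI\<close>)
  then show "\<exists>W. open W \<and> z \<in> W \<and> smooth_on (snd c ` (U \<inter> fst c) \<inter> W) (f \<circ> chart_inv c)"
    using V p c by (intro exI[of _ "snd c ` (V \<inter> fst c)"]) (auto intro: open_chart_image)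
qed

text \<open>Smoothness inside one chart domain has to be tested in that chart only, because any
  other chart differs from it by a smooth transition map.\<close>

lemma smooth_fun_on_chartI:
  assumes c: "c \<in> A" and U: "open U" "U \<subseteq> fst c" and f: "smooth_on (snd c ` U) (f \<circ> chart_inv c)"
  shows "smooth_fun_on A U f"
  unfolding smooth_fun_on_def
proof
  fix e assume e: "e \<in> A"
  let ?S = "snd e ` (U \<inter> fst e)"
  have S: "open ?S" using open_chart_image[OF e U(1)] .
  have "smooth_on ?S ((f \<circ> chart_inv c) \<circ> (snd c \<circ> chart_inv e))"
    by (rule smooth_on_compose[OF S open_chart_image'[OF c U] _ f
          smooth_on_subset[OF smooth_transition[OF e c]]])
       (use U e in auto)
  then show "smooth_on ?S (f \<circ> chart_inv e)"
    by (rule smooth_on_cong[OF S, THEN iffD1, rotated]) (use c e U in auto)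
qed

lemma smooth_fun_on_const: "smooth_fun_on A U (\<lambda>p. c)"
  by (simp add: smooth_fun_on_def o_def smooth_on_const)

lemma smooth_fun_on_sum:
  "open U \<Longrightarrow> (\<And>j. j \<in> I \<Longrightarrow> smooth_fun_on A U (f j)) \<Longrightarrow> smooth_fun_on A U (\<lambda>p. \<Sum>j\<in>I. f j p)"
  by (simp add: smooth_fun_on_def o_def smooth_on_sum open_chart_image)

lemma smooth_fun_on_scaleR:
  "open U \<Longrightarrow> smooth_fun_on A U f \<Longrightarrow> smooth_fun_on A U g \<Longrightarrow> smooth_fun_on A U (\<lambda>p. f p *\<^sub>R g p)"
  by (simp add: smooth_fun_on_def o_def smooth_on_scaleR open_chart_image)

lemma smooth_fun_on_inner:
  "open U \<Longrightarrow> smooth_fun_on A U f \<Longrightarrow> smooth_fun_on A U g \<Longrightarrow> smooth_fun_on A U (\<lambda>p. f p \<bullet> g p)"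
  by (simp add: smooth_fun_on_def o_def smooth_on_inner open_chart_image)

lemma smooth_fun_on_dir_has_derivative:
  assumes "open U" "p \<in> U" "smooth_fun_on A U f"
  shows "(f \<circ> chart_inv (chart_at A p) has_derivative dir_deriv A f p) (at (snd (chart_at A p) p))"
  using smooth_on_has_derivative[OF smooth_fun_onD[OF assms(3) chart_at_in], of "snd (chart_at A p) p" p] assms
  unfolding dir_deriv_def[abs_def] by (simp add: eta_contract_eq)

lemma dir_deriv_eqI:
  "(f \<circ> chart_inv (chart_at A p) has_derivative D) (at (snd (chart_at A p) p)) \<Longrightarrow> dir_deriv A f p = D"
  using frechet_derivative_at by (force simp: dir_deriv_def[abs_def])

lemma dir_deriv_inner:
  assumes "open U" "p \<in> U" "smooth_fun_on A U f"
  shows "dir_deriv A (\<lambda>q. f q \<bullet> b) p u = dir_deriv A f p u \<bullet> b"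
  using dir_deriv_eqI[of "\<lambda>q. f q \<bullet> b"]
    has_derivative_inner_left[OF smooth_fun_on_dir_has_derivative[OF assms], of b]
  by (simp add: o_def)

lemma dir_deriv_sum_scaleR:
  assumes U: "open U" "p \<in> U" and h: "\<And>b. smooth_fun_on A U (h b)" and f: "\<And>b. smooth_fun_on A U (f b)"
  shows "dir_deriv A (\<lambda>q. \<Sum>b\<in>I. (h b q :: real) *\<^sub>R f b q) p u
    = (\<Sum>b\<in>I. h b p *\<^sub>R dir_deriv A (f b) p u + dir_deriv A (h b) p u *\<^sub>R f b p)"
proof -
  have "((\<lambda>z. \<Sum>b\<in>I. (h b \<circ> chart_inv (chart_at A p)) z *\<^sub>R (f b \<circ> chart_inv (chart_at A p)) z) has_derivative
    (\<lambda>u. \<Sum>b\<in>I. (h b \<circ> chart_inv (chart_at A p)) (snd (chart_at A p) p) *\<^sub>R dir_deriv A (f b) p u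
      + dir_deriv A (h b) p u *\<^sub>R (f b \<circ> chart_inv (chart_at A p)) (snd (chart_at A p) p)))
    (at (snd (chart_at A p) p))"
    by (intro has_derivative_sum has_derivative_scaleR smooth_fun_on_dir_has_derivative[OF U] h f)
  then show ?thesis
    using dir_deriv_eqI[of "\<lambda>q. \<Sum>b\<in>I. h b q *\<^sub>R f b q"] by (simp add: o_def)
qed

lemma dir_deriv_cong:
  assumes U: "open U" "p \<in> U" "\<And>q. q \<in> U \<Longrightarrow> f q = g q"
  shows "dir_deriv A f p = dir_deriv A g p"
proof -
  let ?c = "chart_at A p"
  have "frechet_derivative (f \<circ> chart_inv ?c) (at (snd ?c p)) = frechet_derivative (g \<circ> chart_inv ?c) (at (snd ?c p))"
    by (rule frechet_derivative_cong_open[OF open_chart_image[OF chart_at_in U(1)]]) (use U in auto)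
  then show ?thesis by (simp add: dir_deriv_def[abs_def])
qed

lemma smooth_field_iff:
  "smooth_field A U X \<longleftrightarrow> (\<forall>c\<in>A. smooth_fun_on A (U \<inter> fst c) (\<lambda>p. chart_coords A c p (X p)))"
  by (simp add: smooth_field_def smooth_along_def)

text \<open>The component functions of a field in a fixed chart, as a function of the coordinates.
  This is the object that is differentiated in place of the field itself.\<close>

definition field_rep :: "('a, 'e) chart \<Rightarrow> ('a \<Rightarrow> 'e) \<Rightarrow> 'e \<Rightarrow> 'e" where
  "field_rep c X z = chart_coords A c (chart_inv c z) (X (chart_inv c z))"

lemma smooth_field_rep:
  assumes "smooth_field A U X" "c \<in> A"
  shows "smooth_on (snd c ` (U \<inter> fst c)) (field_rep c X)"
proof -
  have "smooth_fun_on A (U \<inter> fst c) (\<lambda>p. chart_coords A c p (X p))"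
    using assms by (simp add: smooth_field_iff)
  from smooth_fun_onD[OF this assms(2)] show ?thesis
    by (simp add: field_rep_def[abs_def] o_def Int_assoc)
qed

lemma smooth_fieldI:
  assumes "open U" "\<And>c. c \<in> A \<Longrightarrow> smooth_on (snd c ` (U \<inter> fst c)) (field_rep c X)"
  shows "smooth_field A U X"
  unfolding smooth_field_iff
proof
  fix c assume "c \<in> A"
  then show "smooth_fun_on A (U \<inter> fst c) (\<lambda>p. chart_coords A c p (X p))"
    using assms open_chart[of c] assms(2)[of c]
    by (intro smooth_fun_on_chartI[of c]) (auto simp: field_rep_def[abs_def] o_def)
qed

text \<open>In another chart \<open>d\<close> the components are a directional derivative of the
  transition map from \<open>c\<close> to \<open>d\<close>, evaluated at the
  \<open>c\<close>-coordinates.\<close>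

lemma smooth_coord_field:
  assumes c: "c \<in> A"
  shows "smooth_field A (fst c) (coord_field A c b)"
proof (rule smooth_fieldI[OF open_chart[OF c]])
  fix d assume d: "d \<in> A"
  have "smooth_on (snd d ` (fst c \<inter> fst d)) ((\<lambda>z. frechet_derivative (snd d \<circ> chart_inv c) (at z) b) \<circ> (snd c \<circ> chart_inv d))"
    by (rule smooth_on_compose[OF open_chart_image[OF d open_chart[OF c]]
          open_chart_image[OF c open_chart[OF d]]  _ smooth_on_derivative])
       (use smooth_transition[OF c d] smooth_transition[OF d c] d in \<open>auto simp: Int_commute\<close>)
  then show "smooth_on (snd d ` (fst c \<inter> fst d)) (field_rep d (coord_field A c b))"
    by (rule smooth_on_cong[OF open_chart_image[OF d open_chart[OF c]], THEN iffD1, rotated])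
       (use c d in \<open>auto simp: field_rep_def chart_coords_coord_field transition_def\<close>)
qed

section \<open>Chart independence of the Lie bracket\<close>

lemma field_rep_transition:
  assumes "c \<in> A" "d \<in> A" "z \<in> snd c ` (fst c \<inter> fst d)"
  shows "frechet_derivative (snd d \<circ> chart_inv c) (at z) (field_rep c X z)
       = field_rep d X ((snd d \<circ> chart_inv c) z)"
  using assms transition_chart_coords[of c d] by (auto simp: field_rep_def transition_def)

text \<open>The bracket is defined in a chart that varies with the point, so its smoothness is not
  visible from the definition. The coordinate formula holds in every chart by
  \<open>pushforward_bracket\<close> for the transition map; with \<open>d\<close> fixed, its
  right-hand side is smooth in the coordinates.\<close>

lemma lie_bracket_rep:
  assumes X: "smooth_field A UNIV X" and Y: "smooth_field A UNIV Y" and d: "d \<in> A" "p \<in> fst d"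
  shows "chart_coords A d p (lie_bracket A X Y p)
    = frechet_derivative (field_rep d Y) (at (snd d p)) (field_rep d X (snd d p))
    - frechet_derivative (field_rep d X) (at (snd d p)) (field_rep d Y (snd d p))"
proof -
  define c where "c = chart_at A p"
  have c: "c \<in> A" "p \<in> fst c" by (auto simp: c_def)
  define S where "S = snd c ` (fst c \<inter> fst d)"
  define \<tau> where "\<tau> = snd d \<circ> chart_inv c"
  have S: "open S" "snd c p \<in> S"
    using open_chart_image[OF c(1) open_chart[OF d(1)]] c d by (auto simp: S_def Int_commute)
  have \<tau>: "smooth_on S \<tau>"
    using smooth_transition c d by (simp add: S_def \<tau>_def)
  have D\<tau>: "frechet_derivative \<tau> (at (snd c p)) = chart_coords A d p"
    by (simp add: \<tau>_def c_def chart_coords_def[abs_def] transition_def[abs_def] eta_contract_eq)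
  have rep: "smooth_on S (field_rep c X)" if "smooth_field A UNIV X" for X
    unfolding S_def by (rule smooth_on_subset[OF smooth_field_rep[OF that c(1)]]) blast
  have bracket: "lie_bracket A X Y p
    = frechet_derivative (field_rep c Y) (at (snd c p)) (field_rep c X (snd c p))
    - frechet_derivative (field_rep c X) (at (snd c p)) (field_rep c Y (snd c p))"
    using c by (simp add: lie_bracket_def dir_deriv_def c_def[symmetric] field_rep_def[abs_def] o_def)
       (simp add: c_def)
  \<comment> \<open>Near the point, the derivative of \<open>\<tau>\<close> applied to the
    \<open>c\<close>-components of \<open>Y\<close> gives the \<open>d\<close>-components composed
    with \<open>\<tau>\<close>. The chain rule then turns the direction of \<open>X\<close> in
    \<open>c\<close> into its direction in \<open>d\<close>.\<close>
  have push: "frechet_derivative (\<lambda>z. frechet_derivative \<tau> (at z) (field_rep c Y z)) (at (snd c p)) (field_rep c X (snd c p))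
    = frechet_derivative (field_rep d Y) (at (snd d p)) (field_rep d X (snd d p))"
    if X: "smooth_field A UNIV X" and Y: "smooth_field A UNIV Y" for X Y
  proof -
    have "frechet_derivative (\<lambda>z. frechet_derivative \<tau> (at z) (field_rep c Y z)) (at (snd c p))
      = frechet_derivative (field_rep d Y \<circ> \<tau>) (at (snd c p))"
      by (rule frechet_derivative_cong_open[OF S])
         (simp add: \<tau>_def S_def field_rep_transition[OF c(1) d(1)] del: o_apply, simp)
    also have "\<dots> = frechet_derivative (field_rep d Y) (at (\<tau> (snd c p))) \<circ> frechet_derivative \<tau> (at (snd c p))"
      using smooth_on_differentiable[OF \<tau> S(2)] smooth_on_differentiable[OF smooth_field_rep[OF Y d(1)], of "\<tau> (snd c p)"] c d
      by (intro frechet_derivative_compose) (auto simp: \<tau>_def)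
    finally show ?thesis
      using field_rep_transition[OF c(1) d(1), of "snd c p" X] S(2) c by (simp add: \<tau>_def S_def)
  qed
  show ?thesis
    using pushforward_bracket[OF S \<tau> rep[OF X] rep[OF Y]] D\<tau>
    by (simp add: push[OF X Y] push[OF Y X] bracket)
qed

lemma smooth_lie_bracket:
  assumes X: "smooth_field A UNIV X" and Y: "smooth_field A UNIV Y"
  shows "smooth_field A UNIV (lie_bracket A X Y)"
proof (rule smooth_fieldI)
  fix d assume d: "d \<in> A"
  let ?S = "snd d ` (UNIV \<inter> fst d)"
  have S: "open ?S" using open_chart_image[OF d] by blast
  have "smooth_on ?S (\<lambda>z. frechet_derivative (field_rep d Y) (at z) (field_rep d X z)
      - frechet_derivative (field_rep d X) (at z) (field_rep d Y z))"
    by (intro smooth_on_diff smooth_on_derivative_field S smooth_field_rep[OF X d] smooth_field_rep[OF Y d])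
  then show "smooth_on ?S (field_rep d (lie_bracket A X Y))"
    by (rule smooth_on_cong[OF S, THEN iffD1, rotated])
       (use d in \<open>auto simp: field_rep_def[of d "lie_bracket A X Y"] lie_bracket_rep[OF X Y]\<close>)
qed simp

end

section \<open>Fields along a smooth map\<close>

locale manifold_map = M: manifold A + N: manifold A'
  for A :: "('b::{t2_space,second_countable_topology}, 'm::euclidean_space) chart set"
    and A' :: "('a::{t2_space,second_countable_topology}, 'e::euclidean_space) chart set" +
  fixes i :: "'b \<Rightarrow> 'a"
  assumes smooth_map: "smooth_map A A' i"
begin

lemma open_vimage_chart: "d \<in> A' \<Longrightarrow> open (i -` fst d)"
  using smooth_map N.open_chart by (auto simp: smooth_map_def open_vimage)

lemma open_vimage_open: "open U \<Longrightarrow> open (i -` U)"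
  using smooth_map by (auto simp: smooth_map_def open_vimage)

lemma smooth_map_rep:
  assumes "c \<in> A" "d \<in> A'"
  shows "smooth_on (snd c ` (i -` fst d \<inter> fst c)) (snd d \<circ> i \<circ> chart_inv c)"
  using smooth_map M.smooth_fun_onD[of "i -` fst d" "snd d \<circ> i" c] assms by (simp add: smooth_map_def)

lemma differential_has_derivative:
  "(snd (chart_at A' (i q)) \<circ> i \<circ> chart_inv (chart_at A q) has_derivative differential A A' i q)
    (at (snd (chart_at A q) q))"
  using smooth_on_has_derivative[OF smooth_map_rep[OF M.chart_at_in N.chart_at_in],
      of "snd (chart_at A q) q" q "i q"]
  by (simp add: differential_def[abs_def] dir_deriv_def o_assoc eta_contract_eq)

text \<open>\<open>differential\<close> is defined by the charts chosen at \<open>q\<close> and at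
  \<open>i q\<close>. The chain rule with a transition map on either side replaces them by arbitrary
  fixed charts, the form in which \<open>q\<close> can vary.\<close>

lemma differential_rep:
  assumes c: "c \<in> A" "q \<in> fst c" and d: "d \<in> A'" "i q \<in> fst d"
  shows "chart_coords A' d (i q) (differential A A' i q u)
       = frechet_derivative (snd d \<circ> i \<circ> chart_inv c) (at (snd c q)) (chart_coords A c q u)"
proof -
  define e where "e = chart_at A q"
  define e' where "e' = chart_at A' (i q)"
  have e: "e \<in> A" "q \<in> fst e" and e': "e' \<in> A'" "i q \<in> fst e'" by (auto simp: e_def e'_def)
  have "(snd e' \<circ> i \<circ> chart_inv e has_derivative differential A A' i q) (at (snd e q))"
    using differential_has_derivative by (simp add: e_def e'_def)
  then have "(snd d \<circ> chart_inv e' \<circ> (snd e' \<circ> i \<circ> chart_inv e) has_derivative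
      transition e' d (i q) \<circ> differential A A' i q) (at (snd e q))"
    by (rule diff_chain_at) (use N.transition_has_derivative e e' d in auto)
  then have 1: "(snd d \<circ> i \<circ> chart_inv e has_derivative transition e' d (i q) \<circ> differential A A' i q) (at (snd e q))"
    by (rule has_derivative_transform_within_open[OF _ M.open_chart_image[OF e(1) open_vimage_chart[OF e'(1)]]])
       (use e e' in auto)
  have "(snd d \<circ> i \<circ> chart_inv c has_derivative frechet_derivative (snd d \<circ> i \<circ> chart_inv c) (at (snd c q))) (at (snd c q))"
    by (rule smooth_on_has_derivative[OF smooth_map_rep[OF c(1) d(1)]]) (use c d in auto)
  from M.has_derivative_change_chart[OF c e this]
  have "(snd d \<circ> i \<circ> chart_inv e has_derivative
      frechet_derivative (snd d \<circ> i \<circ> chart_inv c) (at (snd c q)) \<circ> transition e c q) (at (snd e q))" .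
  from has_derivative_unique[OF 1 this] show ?thesis
    by (simp add: fun_eq_iff chart_coords_def e_def e'_def)
qed

lemma linear_differential: "linear (differential A A' i q)"
  using has_derivative_linear differential_has_derivative by blast

lemma dir_deriv_pullback:
  assumes U: "open U" "i p \<in> U" and h: "smooth_fun_on A' U h"
  shows "dir_deriv A (h \<circ> i) p u = dir_deriv A' h (i p) (differential A A' i p u)"
proof -
  let ?c = "chart_at A p" and ?d = "chart_at A' (i p)"
  have "(h \<circ> chart_inv ?d \<circ> (snd ?d \<circ> i \<circ> chart_inv ?c) has_derivative
      dir_deriv A' h (i p) \<circ> differential A A' i p) (at (snd ?c p))"
    by (rule diff_chain_at[OF differential_has_derivative])
       (use N.smooth_fun_on_dir_has_derivative[OF U h] in simp)
  then have "(h \<circ> i \<circ> chart_inv ?c has_derivative dir_deriv A' h (i p) \<circ> differential A A' i p) (at (snd ?c p))"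
    by (rule has_derivative_transform_within_open[OF _
          M.open_chart_image[OF M.chart_at_in open_vimage_chart[OF N.chart_at_in], of p "i p"]]) auto
  from M.dir_deriv_eqI[OF this] show ?thesis by simp
qed

lemma smooth_alongD:
  "smooth_along A A' i U V \<Longrightarrow> d \<in> A' \<Longrightarrow>
    smooth_fun_on A (U \<inter> i -` fst d) (\<lambda>p. chart_coords A' d (i p) (V p))"
  by (simp add: smooth_along_def)

lemma smooth_along_local:
  assumes "\<And>p. p \<in> U \<Longrightarrow> \<exists>W. open W \<and> p \<in> W \<and> smooth_along A A' i (U \<inter> W) V"
  shows "smooth_along A A' i U V"
  unfolding smooth_along_def
proof (intro ballI M.smooth_fun_on_local)
  fix d p assume d: "d \<in> A'" and p: "p \<in> U \<inter> i -` fst d"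
  then obtain W where W: "open W" "p \<in> W" "smooth_along A A' i (U \<inter> W) V"
    using assms by blast
  have "smooth_fun_on A (U \<inter> i -` fst d \<inter> W) (\<lambda>p. chart_coords A' d (i p) (V p))"
    using smooth_alongD[OF W(3) d] by (rule M.smooth_fun_on_subset) blast
  with W show "\<exists>W. open W \<and> p \<in> W \<and>
      smooth_fun_on A (U \<inter> i -` fst d \<inter> W) (\<lambda>p. chart_coords A' d (i p) (V p))"
    by blast
qed

lemma smooth_along_subset: "smooth_along A A' i U V \<Longrightarrow> W \<subseteq> U \<Longrightarrow> smooth_along A A' i W V"
  unfolding smooth_along_def by (meson Int_mono M.smooth_fun_on_subset order_refl)

lemma smooth_along_cong:
  assumes "open U" "\<And>p. p \<in> U \<Longrightarrow> V p = W p"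
  shows "smooth_along A A' i U V \<longleftrightarrow> smooth_along A A' i U W"
  unfolding smooth_along_def
  by (intro ball_cong refl M.smooth_fun_on_cong open_Int assms(1) open_vimage_chart) (use assms(2) in auto)

lemma smooth_along_sum:
  assumes U: "open U" and f: "\<And>j. j \<in> I \<Longrightarrow> smooth_fun_on A U (f j)"
    and V: "\<And>j. j \<in> I \<Longrightarrow> smooth_along A A' i U (V j)"
  shows "smooth_along A A' i U (\<lambda>p. \<Sum>j\<in>I. f j p *\<^sub>R V j p)"
  unfolding smooth_along_def
proof
  fix d assume d: "d \<in> A'"
  let ?U = "U \<inter> i -` fst d"
  have oU: "open ?U" using U open_vimage_chart[OF d] by blast
  have "smooth_fun_on A ?U (\<lambda>p. \<Sum>j\<in>I. f j p *\<^sub>R chart_coords A' d (i p) (V j p))"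
    by (intro M.smooth_fun_on_sum M.smooth_fun_on_scaleR oU smooth_alongD[OF V d]
        M.smooth_fun_on_subset[OF f]) auto
  then show "smooth_fun_on A ?U (\<lambda>p. chart_coords A' d (i p) (\<Sum>j\<in>I. f j p *\<^sub>R V j p))"
    by (rule M.smooth_fun_on_cong[OF oU, THEN iffD1, rotated])
       (use d in \<open>simp add: linear_sum[OF N.linear_chart_coords] linear_cmul[OF N.linear_chart_coords]\<close>)
qed

lemma smooth_along_zero: "smooth_along A A' i U (\<lambda>p. 0)"
proof (rule smooth_along_subset)
  show "smooth_along A A' i UNIV (\<lambda>p. 0)"
    using smooth_along_sum[of UNIV "{}"] by simp
qed simp

lemma smooth_fun_on_pullback:
  assumes U: "open U" and h: "smooth_fun_on A' U h"
  shows "smooth_fun_on A (i -` U) (h \<circ> i)"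
proof (rule M.smooth_fun_on_local)
  fix p assume p: "p \<in> i -` U"
  define c where "c = chart_at A p"
  define d where "d = chart_at A' (i p)"
  have c: "c \<in> A" "p \<in> fst c" and d: "d \<in> A'" "i p \<in> fst d" by (auto simp: c_def d_def)
  let ?V = "i -` fst d \<inter> fst c"
  have V: "open ?V" "p \<in> ?V" using c d open_Int[OF open_vimage_chart[OF d(1)] M.open_chart[OF c(1)]] by simp_all
  have W: "open (i -` U \<inter> ?V)" using V open_vimage_open[OF U] by blast
  have S: "open (snd c ` (i -` U \<inter> ?V))" using M.open_chart_image'[OF c(1) W] by blast
  have "smooth_on (snd c ` (i -` U \<inter> ?V)) ((h \<circ> chart_inv d) \<circ> (snd d \<circ> i \<circ> chart_inv c))"
    by (rule smooth_on_compose[OF S N.open_chart_image[OF d(1) U] _ N.smooth_fun_onD[OF h d(1)]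
          smooth_on_subset[OF smooth_map_rep[OF c(1) d(1)]]]) (use c in auto)
  then have "smooth_on (snd c ` (i -` U \<inter> ?V)) (h \<circ> i \<circ> chart_inv c)"
    by (rule smooth_on_cong[OF S, THEN iffD1, rotated]) (use c d in auto)
  from M.smooth_fun_on_chartI[OF c(1) W _ this] V
  show "\<exists>V. open V \<and> p \<in> V \<and> smooth_fun_on A (i -` U \<inter> V) (h \<circ> i)" by blast
qed

lemma smooth_along_differential:
  assumes X: "smooth_field A UNIV X"
  shows "smooth_along A A' i UNIV (\<lambda>p. differential A A' i p (X p))"
  unfolding smooth_along_def
proof
  fix d assume d: "d \<in> A'"
  let ?U = "UNIV \<inter> i -` fst d"
  have U: "open ?U" using open_vimage_chart[OF d] by simp
  show "smooth_fun_on A ?U (\<lambda>p. chart_coords A' d (i p) (differential A A' i p (X p)))"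
    unfolding smooth_fun_on_def
  proof
    fix c assume c: "c \<in> A"
    let ?S = "snd c ` (?U \<inter> fst c)"
    have S: "open ?S" using M.open_chart_image[OF c U] .
    have "smooth_on ?S (\<lambda>z. frechet_derivative (snd d \<circ> i \<circ> chart_inv c) (at z) (M.field_rep c X z))"
      by (intro smooth_on_derivative_field[OF S] smooth_on_subset[OF M.smooth_field_rep[OF X c]])
         (use smooth_map_rep[OF c d] in auto)
    then show "smooth_on ?S ((\<lambda>p. chart_coords A' d (i p) (differential A A' i p (X p))) \<circ> chart_inv c)"
      by (rule smooth_on_cong[OF S, THEN iffD1, rotated])
         (use c d in \<open>auto simp: M.field_rep_def differential_rep[OF c _ d]\<close>)
  qed
qed

end

section \<open>Connections along a smooth map\<close>

context manifold
begin

lemma affine_connectionD: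
  assumes "affine_connection A nabla" "open U" "smooth_field A U Y" "p \<in> U"
  shows "linear (\<lambda>u. nabla p u Y)"
    and "smooth_field A U Z \<Longrightarrow> nabla p u (\<lambda>q. Y q + Z q) = nabla p u Y + nabla p u Z"
    and "smooth_fun_on A U f \<Longrightarrow>
      nabla p u (\<lambda>q. f q *\<^sub>R Y q) = dir_deriv A f p u *\<^sub>R Y p + f p *\<^sub>R nabla p u Y"
  using assms(1)[unfolded affine_connection_def, THEN spec, THEN spec, THEN mp, THEN mp, OF assms(2,3)] assms(4)
  by auto

text \<open>Vector fields are by definition fields along \<open>id\<close>, so all lemmas on fields
  along a map become available for them.\<close>

sublocale id: manifold_map A A id
proof
  have "smooth_fun_on A (fst d) (snd d)" if "d \<in> A" for d
    using smooth_fun_on_chartI[OF that open_chart[OF that] order_refl]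
      smooth_on_cong[OF open_chart_image'[OF that open_chart[OF that] order_refl], of "\<lambda>z. z" "snd d \<circ> chart_inv d"]
      smooth_on_linear[OF bounded_linear_ident] that chart_inv_right by auto
  then show "smooth_map A A id"
    by (simp add: smooth_map_def continuous_on_id)
qed

text \<open>Multiplication by the indicator function of \<open>U\<close>, which is smooth on \<open>U\<close>, turns \<open>Y\<close> and \<open>Z\<close>
  into the same field.\<close>

lemma connection_local:
  assumes nabla: "affine_connection A nabla" and U: "open U" "p \<in> U"
    and Y: "smooth_field A U Y" and YZ: "\<And>q. q \<in> U \<Longrightarrow> Y q = Z q"
  shows "nabla p u Y = nabla p u Z"
proof -
  have Z: "smooth_field A U Z"
    using Y id.smooth_along_cong[OF U(1) YZ] by (simp add: smooth_field_def)
  define f :: "'a \<Rightarrow> real" where "f q = (if q \<in> U then 1 else 0)" for q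
  have f: "smooth_fun_on A U f"
    using smooth_fun_on_cong[OF U(1), of f "\<lambda>_. 1"] smooth_fun_on_const by (simp add: f_def)
  have "dir_deriv A f p u = dir_deriv A (\<lambda>_. 1) p u"
    by (rule fun_cong[OF dir_deriv_cong[OF U]]) (simp add: f_def)
  then have f': "dir_deriv A f p u = 0" "f p = 1"
    using U by (simp_all add: dir_deriv_def o_def f_def)
  have "(\<lambda>q. f q *\<^sub>R Y q) = (\<lambda>q. f q *\<^sub>R Z q)"
    using YZ by (auto simp: f_def)
  then show ?thesis
    using affine_connectionD(3)[OF nabla U(1) Y U(2) f, of u]
      affine_connectionD(3)[OF nabla U(1) Z U(2) f, of u] f' by simp
qed

lemma connection_sum:
  assumes nabla: "affine_connection A nabla" and U: "open U" "p \<in> U"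
    and Y: "\<And>j. j \<in> I \<Longrightarrow> smooth_field A U (Y j)" and f: "\<And>j. j \<in> I \<Longrightarrow> smooth_fun_on A U (f j)"
  shows "nabla p u (\<lambda>q. \<Sum>j\<in>I. (f j q :: real) *\<^sub>R Y j q)
    = (\<Sum>j\<in>I. dir_deriv A (f j) p u *\<^sub>R Y j p + f j p *\<^sub>R nabla p u (Y j))"
proof -
  \<comment> \<open>From additivity applied to \<open>0 + 0\<close>. This covers the empty and the
    infinite index set, where the sums vanish.\<close>
  have zero: "nabla p u (\<lambda>q. 0) = 0"
    using affine_connectionD(2)[OF nabla U(1) _ U(2), of "\<lambda>q. 0" "\<lambda>q. 0" u] id.smooth_along_zero
    by (simp add: smooth_field_def)
  show ?thesis using Y f
  proof (induction I rule: infinite_finite_induct)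
    case (insert j I)
    have "smooth_field A U (\<lambda>q. f j q *\<^sub>R Y j q)"
      using id.smooth_along_sum[OF U(1), of "{j}" f Y] insert.prems by (simp add: smooth_field_def)
    moreover have "smooth_field A U (\<lambda>q. \<Sum>j\<in>I. f j q *\<^sub>R Y j q)"
      using id.smooth_along_sum[OF U(1), of I f Y] insert.prems by (simp add: smooth_field_def)
    ultimately show ?case
      using insert affine_connectionD(2)[OF nabla U(1) _ U(2)]
        affine_connectionD(3)[OF nabla U(1) insert.prems(1) U(2) insert.prems(2), of j] by simp
  qed (simp_all add: zero)
qed

section \<open>Symmetry of the Christoffel symbols\<close>

lemma lie_bracket_coord_field:
  "lie_bracket A (coord_field A (chart_at A p) a) (coord_field A (chart_at A p) b) p = 0"
proof -
  \<comment> \<open>In its own chart a coordinate field has constant components on the whole chart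
    domain, hence derivative zero.\<close>
  have "dir_deriv A (\<lambda>q. chart_coords A (chart_at A p) q (coord_field A (chart_at A p) b q)) p
    = dir_deriv A (\<lambda>q. b) p" for b
    by (rule dir_deriv_cong[OF open_chart[OF chart_at_in[of p]]])
       (simp_all add: chart_coords_coord_field)
  then show ?thesis by (simp add: lie_bracket_def dir_deriv_def o_def)
qed

text \<open>Torsion-freeness for two commuting coordinate fields of the chart chosen at
  \<open>p\<close>; in that chart their values at \<open>p\<close> are \<open>a\<close> and
  \<open>b\<close> themselves.\<close>

lemma christoffel_symmetric:
  assumes "levi_civita_connection A g nabla"
  shows "nabla p a (coord_field A (chart_at A p) b) = nabla p b (coord_field A (chart_at A p) a)"
proof -
  have "open (fst (chart_at A p))" "p \<in> fst (chart_at A p)"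
    by (simp_all add: open_chart)
  then have "nabla p (coord_field A (chart_at A p) a p) (coord_field A (chart_at A p) b)
      - nabla p (coord_field A (chart_at A p) b p) (coord_field A (chart_at A p) a)
      = lie_bracket A (coord_field A (chart_at A p) a) (coord_field A (chart_at A p) b) p"
    using conjunct2[OF assms[unfolded levi_civita_connection_def], THEN spec, THEN spec, THEN spec,
        THEN mp, THEN mp, THEN mp, OF _ smooth_coord_field[OF chart_at_in] smooth_coord_field[OF chart_at_in]]
    by blast
  then show ?thesis by (simp add: lie_bracket_coord_field)
qed

end

context manifold_map
begin

text \<open>In coordinates the covariant derivative of a pushed-forward field is an ordinary
  derivative plus \<open>\<Gamma>\<close> evaluated on the two pushed-forward vectors. The
  \<open>\<Gamma>\<close> terms cancel by symmetry, and the rest is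
  \<open>pushforward_bracket\<close> for the coordinate form of \<open>i\<close>. The fields need
  not be extended to the ambient manifold.\<close>

lemma cov_along_torsion_free:
  assumes nabla: "levi_civita_connection A' g nabla"
    and X: "smooth_field A UNIV X" and Y: "smooth_field A UNIV Y"
  shows "cov_along A A' i nabla p (X p) (\<lambda>q. differential A A' i q (Y q))
       - cov_along A A' i nabla p (Y p) (\<lambda>q. differential A A' i q (X q))
       = differential A A' i p (lie_bracket A X Y p)"
proof -
  define c where "c = chart_at A p"
  define d where "d = chart_at A' (i p)"
  have c: "c \<in> A" "p \<in> fst c" and d: "d \<in> A'" "i p \<in> fst d" by (auto simp: c_def d_def)
  define S where "S = snd c ` (i -` fst d \<inter> fst c)"
  define \<tau> where "\<tau> = snd d \<circ> i \<circ> chart_inv c"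
  have S: "open S" "snd c p \<in> S"
    using M.open_chart_image[OF c(1) open_vimage_chart[OF d(1)]] c d by (auto simp: S_def)
  have \<tau>: "smooth_on S \<tau>"
    using smooth_map_rep c d by (simp add: S_def \<tau>_def)
  have rep: "smooth_on S (M.field_rep c X)" if "smooth_field A UNIV X" for X
    unfolding S_def by (rule smooth_on_subset[OF M.smooth_field_rep[OF that c(1)]]) blast
  have rep_p: "M.field_rep c X (snd c p) = X p" for X
    using c by (simp add: M.field_rep_def) (simp add: c_def)
  have push: "dir_deriv A (\<lambda>q. chart_coords A' d (i q) (differential A A' i q (Y q))) p u
    = frechet_derivative (\<lambda>z. frechet_derivative \<tau> (at z) (M.field_rep c Y z)) (at (snd c p)) u" for Y u
    unfolding dir_deriv_def c_def[symmetric]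
    by (rule fun_cong[OF frechet_derivative_cong_open[OF S]])
       (use c d in \<open>auto simp: S_def \<tau>_def M.field_rep_def differential_rep[OF c(1) _ d(1)]\<close>)
  have \<tau>_diff: "frechet_derivative \<tau> (at (snd c p)) u = differential A A' i p u" for u
    using differential_rep[OF c d, of u] by (simp add: \<tau>_def) (simp add: c_def d_def)
  have bracket: "lie_bracket A X Y p
    = frechet_derivative (M.field_rep c Y) (at (snd c p)) (X p)
    - frechet_derivative (M.field_rep c X) (at (snd c p)) (Y p)"
    using M.lie_bracket_rep[OF X Y c] by (simp add: rep_p) (simp add: c_def)
  define \<Gamma> where "\<Gamma> a b = nabla (i p) a (coord_field A' d b)" for a b
  have \<Gamma>_lin: "linear (\<lambda>a. \<Gamma> a b)" for b
    unfolding \<Gamma>_def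
    by (rule N.affine_connectionD(1)[OF _ N.open_chart[OF d(1)] N.smooth_coord_field[OF d(1)] d(2)])
       (use nabla in \<open>simp add: levi_civita_connection_def\<close>)
  have \<Gamma>_sym: "\<Gamma> a b = \<Gamma> b a" for a b
    using N.christoffel_symmetric[OF nabla] by (simp add: \<Gamma>_def d_def)
  \<comment> \<open>Linearity of \<open>\<Gamma>\<close> has been established in its first slot;
    symmetry moves the summation there.\<close>
  have \<Gamma>: "(\<Sum>b\<in>Basis. (v \<bullet> b) *\<^sub>R \<Gamma> u b) = \<Gamma> u v" for u v
    using linear_euclidean_sum[OF \<Gamma>_lin, of v u] \<Gamma>_sym by simp
  have cov: "cov_along A A' i nabla p u (\<lambda>q. differential A A' i q (Y q))
    = frechet_derivative (\<lambda>z. frechet_derivative \<tau> (at z) (M.field_rep c Y z)) (at (snd c p)) u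
      + \<Gamma> (differential A A' i p u) (differential A A' i p (Y p))" for u Y
    by (simp add: cov_along_def Let_def d_def[symmetric] push \<Gamma>_def[symmetric] \<Gamma>)
  show ?thesis
    using pushforward_bracket[OF S \<tau> rep[OF X] rep[OF Y]]
      \<Gamma>_sym[of "differential A A' i p (X p)" "differential A A' i p (Y p)"]
    unfolding cov bracket \<tau>_diff rep_p by (simp only: add_diff_add diff_self add_0_right)
qed

text \<open>Parallelism speaks about ambient fields, so it is applied to the coordinate fields
  \<open>E b\<close>. The general case follows by expanding \<open>V\<close> in them with
  coefficients on the submanifold and using the product rule for these coefficients.\<close>

lemma cov_along_parallel:
  assumes nabla: "affine_connection A' nabla" and J: "smooth_endomorphism_field A' J"
    and par: "parallel_endomorphism A' nabla J" and V: "smooth_along A A' i UNIV V"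
  shows "cov_along A A' i nabla p u (\<lambda>q. J (i q) (V q)) = J (i p) (cov_along A A' i nabla p u V)"
proof -
  define d where "d = chart_at A' (i p)"
  have d: "d \<in> A'" "i p \<in> fst d" by (auto simp: d_def)
  note U = N.open_chart[OF d(1)] d(2)
  define W where "W = i -` fst d"
  have W: "open W" "p \<in> W" using open_vimage_chart d by (auto simp: W_def)
  define w where "w = differential A A' i p u"
  define E where "E = coord_field A' d"
  define Vd where "Vd q = chart_coords A' d (i q) (V q)" for q
  \<comment> \<open>\<open>j b\<close> collects the components of \<open>J\<close> applied to the
    coordinate field \<open>E b\<close>, that is, a column of the matrix of \<open>J\<close> in the
    chart \<open>d\<close>.\<close>
  define j where "j b x = chart_coords A' d x (J x (E b x))" for b x
  define \<Phi> where "\<Phi> v = (\<Sum>b\<in>Basis. (v \<bullet> b) *\<^sub>R nabla (i p) w (E b))" for v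
  have Jlin: "linear (J x)" for x using J by (simp add: smooth_endomorphism_field_def)
  have \<Phi>_lin: "linear \<Phi>"
    by (auto intro!: linearI simp: \<Phi>_def inner_left_distrib scaleR_left_distrib sum.distrib scaleR_right.sum)
  have E_p: "E b (i p) = b" for b by (simp add: E_def d_def)
  have E: "smooth_field A' (fst d) (E b)" for b
    unfolding E_def by (rule N.smooth_coord_field[OF d(1)])
  have JE: "smooth_field A' (fst d) (\<lambda>x. J x (E b x))" for b
    using J U(1) E by (simp add: smooth_endomorphism_field_def)
  have j: "smooth_fun_on A' (fst d) (j b)" for b
    using JE[of b, unfolded N.smooth_field_iff, rule_format, OF d(1)] by (simp add: j_def[abs_def])
  have j_p: "j b (i p) = J (i p) b" for b
    by (simp add: j_def E_p) (simp add: d_def)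
  have Vd: "smooth_fun_on A W Vd"
    using smooth_alongD[OF V d(1)] by (simp add: W_def Vd_def[abs_def])
  have Vd_p: "Vd p = V p" by (simp add: Vd_def d_def)
  have expand: "v = (\<Sum>b\<in>Basis. (chart_coords A' d x v \<bullet> b) *\<^sub>R E b x)" if "x \<in> fst d" for x v
    using linear_euclidean_sum[OF N.linear_coord_field[OF d(1) that], of "chart_coords A' d x v"]
    by (simp add: E_def N.coord_field_chart_coords[OF d(1) that])
  have JV: "chart_coords A' d (i q) (J (i q) (V q)) = (\<Sum>b\<in>Basis. (Vd q \<bullet> b) *\<^sub>R (j b \<circ> i) q)"
    if "q \<in> W" for q
  proof -
    have q: "i q \<in> fst d" using that by (simp add: W_def)
    have "J (i q) (V q) = (\<Sum>b\<in>Basis. (Vd q \<bullet> b) *\<^sub>R J (i q) (E b (i q)))"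
      by (subst expand[OF q, of "V q"]) (simp add: linear_sum[OF Jlin] linear_cmul[OF Jlin] Vd_def)
    then show ?thesis
      by (simp add: j_def linear_sum[OF N.linear_chart_coords[OF d(1) q]]
          linear_cmul[OF N.linear_chart_coords[OF d(1) q]])
  qed
  have ji: "smooth_fun_on A W (j b \<circ> i)" for b
    unfolding W_def by (rule smooth_fun_on_pullback[OF U(1) j])
  have Vb: "smooth_fun_on A W (\<lambda>q. Vd q \<bullet> b)" for b
    by (intro M.smooth_fun_on_inner W Vd M.smooth_fun_on_const)
  have "dir_deriv A (\<lambda>q. chart_coords A' d (i q) (J (i q) (V q))) p u
    = dir_deriv A (\<lambda>q. \<Sum>b\<in>Basis. (Vd q \<bullet> b) *\<^sub>R (j b \<circ> i) q) p u"
    by (rule fun_cong[OF M.dir_deriv_cong[OF W JV]])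
  also have "\<dots> = (\<Sum>b\<in>Basis. (Vd p \<bullet> b) *\<^sub>R dir_deriv A (j b \<circ> i) p u + dir_deriv A (\<lambda>q. Vd q \<bullet> b) p u *\<^sub>R j b (i p))"
    using M.dir_deriv_sum_scaleR[where h="\<lambda>b q. Vd q \<bullet> b" and f="\<lambda>b. j b \<circ> i", OF W Vb ji] by simp
  also have "\<dots> = (\<Sum>b\<in>Basis. (V p \<bullet> b) *\<^sub>R dir_deriv A' (j b) (i p) w + (dir_deriv A Vd p u \<bullet> b) *\<^sub>R J (i p) b)"
    by (simp add: dir_deriv_pullback[OF U j] M.dir_deriv_inner[OF W Vd] j_p w_def Vd_p)
  finally have D: "dir_deriv A (\<lambda>q. chart_coords A' d (i q) (J (i q) (V q))) p u
    = (\<Sum>b\<in>Basis. (V p \<bullet> b) *\<^sub>R dir_deriv A' (j b) (i p) w) + J (i p) (dir_deriv A Vd p u)"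
    using linear_euclidean_sum[OF Jlin, of "i p" "dir_deriv A Vd p u"] by (simp add: sum.distrib)
  \<comment> \<open>The vanishing of \<open>\<nabla>J\<close> in components: the product rule for
    \<open>J E_b\<close> written in the fields \<open>E a\<close> yields the derivative of the
    matrix column plus the connection term.\<close>
  have nablaJE: "J (i p) (nabla (i p) w (E b)) = dir_deriv A' (j b) (i p) w + \<Phi> (J (i p) b)" for b
  proof -
    have ja: "smooth_fun_on A' (fst d) (\<lambda>x. j b x \<bullet> a)" for a
      by (intro N.smooth_fun_on_inner U j N.smooth_fun_on_const)
    have "J (i p) (nabla (i p) w (E b)) = nabla (i p) w (\<lambda>x. J x (E b x))"
      using par[unfolded parallel_endomorphism_def, THEN spec, THEN spec, THEN mp, THEN mp, OF U(1) E] U(2)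
      by simp
    \<comment> \<open>The expansion in coordinate fields holds on the chart domain only, which is
      enough because a connection sees only germs.\<close>
    also have "\<dots> = nabla (i p) w (\<lambda>x. \<Sum>a\<in>Basis. (j b x \<bullet> a) *\<^sub>R E a x)"
      by (rule N.connection_local[OF nabla U JE]) (simp add: j_def expand[symmetric])
    also have "\<dots> = (\<Sum>a\<in>Basis. (dir_deriv A' (j b) (i p) w \<bullet> a) *\<^sub>R a + (J (i p) b \<bullet> a) *\<^sub>R nabla (i p) w (E a))"
      by (simp add: N.connection_sum[OF nabla U E ja] N.dir_deriv_inner[OF U j] E_p j_p)
    finally show ?thesis
      by (simp add: sum.distrib euclidean_representation \<Phi>_def)
  qed
  have cov: "cov_along A A' i nabla p u V' = dir_deriv A (\<lambda>q. chart_coords A' d (i q) (V' q)) p u + \<Phi> (V' p)" for V'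
    by (simp add: cov_along_def Let_def \<Phi>_def w_def E_def d_def)
  have "J (i p) (\<Phi> (V p)) = (\<Sum>b\<in>Basis. (V p \<bullet> b) *\<^sub>R J (i p) (nabla (i p) w (E b)))"
    by (simp add: \<Phi>_def linear_sum[OF Jlin] linear_cmul[OF Jlin])
  also have "\<dots> = (\<Sum>b\<in>Basis. (V p \<bullet> b) *\<^sub>R dir_deriv A' (j b) (i p) w) + (\<Sum>b\<in>Basis. (V p \<bullet> b) *\<^sub>R \<Phi> (J (i p) b))"
    by (simp add: nablaJE scaleR_right_distrib sum.distrib)
  also have "(\<Sum>b\<in>Basis. (V p \<bullet> b) *\<^sub>R \<Phi> (J (i p) b)) = \<Phi> (J (i p) (V p))"
    using linear_euclidean_sum[OF linear_compose[OF Jlin[of "i p"] \<Phi>_lin], of "V p"] by simp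
  finally show ?thesis
    by (simp add: cov D linear_add[OF Jlin] Vd_def[abs_def, symmetric])
qed

text \<open>The correction depends only on the value of the differentiated field. At
  \<open>i p\<close> the coordinate fields are the basis vectors, so linearity of \<open>g\<close>
  reassembles the sum over the basis into the value at \<open>V p\<close>.\<close>

lemma cov_along_lm_connection:
  assumes "bilinear (g (i p))"
  shows "cov_along A A' i (lm_connection g J nabla l m \<eta>) p u V
    = cov_along A A' i nabla p u V + g (i p) (V p) (\<eta> (i p)) *\<^sub>R
        (l (i p) *\<^sub>R differential A A' i p u + m (i p) *\<^sub>R J (i p) (differential A A' i p u))"
proof -
  have "linear (\<lambda>v. g (i p) v (\<eta> (i p)))"
    using assms by (simp add: bilinear_def)
  then have "(\<Sum>b\<in>Basis. (V p \<bullet> b) *\<^sub>R g (i p) b (\<eta> (i p)) *\<^sub>R K) = g (i p) (V p) (\<eta> (i p)) *\<^sub>R K" for K :: 'e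
    using linear_euclidean_sum[of "\<lambda>v. g (i p) v (\<eta> (i p))" "V p"]
    by (simp add: scaleR_sum_left)
  then show ?thesis
    by (simp add: cov_along_def Let_def lm_connection_def scaleR_right_distrib[of "_ \<bullet> _"] sum.distrib)
qed

end

section \<open>Extension of vectors to sections\<close>

text \<open>For \<open>t > 0\<close> this is \<open>t\<^sup>-\<^sup>n exp (-1/t)\<close>; the family is closed under differentiation up to
  linear combinations.\<close>

definition flat :: "nat \<Rightarrow> real \<Rightarrow> real" where
  "flat n t = (if t > 0 then inverse t ^ n * exp (- inverse t) else 0)"

lemma flat_pos: "t > 0 \<Longrightarrow> flat n t > 0" and flat_nonpos: "t \<le> 0 \<Longrightarrow> flat n t = 0"
  by (simp_all add: flat_def)

text \<open>On the right of 0 the substitution \<open>s = 1/t\<close> reduces the claim to the limit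
  of \<open>s^n / exp s\<close> at infinity.\<close>

lemma flat_tendsto_0: "(flat n \<longlongrightarrow> 0) (at 0)"
  unfolding filterlim_at_split
proof
  show "(flat n \<longlongrightarrow> 0) (at_left 0)"
    by (rule tendsto_eventually) (auto simp: flat_def eventually_at_filter)
  have "((\<lambda>t. inverse t ^ n / exp (inverse t)) \<longlongrightarrow> 0) (at_right (0::real))"
    by (rule filterlim_compose[OF tendsto_power_div_exp_0 filterlim_inverse_at_top_right])
  then show "(flat n \<longlongrightarrow> 0) (at_right 0)"
    by (rule Lim_transform_eventually)
       (auto simp: flat_def eventually_at_filter exp_minus divide_inverse)
qed

lemma flat_has_derivative: "(flat n has_real_derivative flat (n + 2) t - n * flat (n + 1) t) (at t)"
proof -
  consider "t < 0" | "t = 0" | "t > 0" by linarith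
  then show ?thesis
  proof cases
    case 1
    have "((\<lambda>_. 0) has_real_derivative 0) (at t)" by simp
    then have "(flat n has_real_derivative 0) (at t)"
      by (rule has_field_derivative_transform_within_open[of _ _ _ "{..<0}"]) (use 1 in \<open>auto simp: flat_def\<close>)
    then show ?thesis using 1 by (simp add: flat_def)
  next
    case 2
    \<comment> \<open>Division by \<open>h\<close> raises the exponent: for nonzero \<open>h\<close>
      the difference quotient at 0 is \<open>flat (n + 1) h\<close>.\<close>
    have "((\<lambda>h. (flat n (0 + h) - flat n 0) / h) \<longlongrightarrow> 0) (at 0)"
      by (rule Lim_transform_eventually[OF flat_tendsto_0[of "n + 1"]])
         (auto simp: flat_def eventually_at_filter field_simps)
    then show ?thesis using 2 by (simp add: DERIV_def flat_def)
  next
    case 3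
    have "((\<lambda>t. inverse t ^ n) has_real_derivative real n * (- (inverse t ^ Suc (Suc 0)) * inverse t ^ (n - Suc 0))) (at t)"
      using 3 by (intro DERIV_power DERIV_inverse) simp
    moreover have "((\<lambda>t. exp (- inverse t)) has_real_derivative exp (- inverse t) * inverse t ^ Suc (Suc 0)) (at t)"
      using 3 DERIV_fun_exp[OF DERIV_minus[OF DERIV_inverse[of t]]] by simp
    ultimately have "((\<lambda>t. inverse t ^ n * exp (- inverse t)) has_real_derivative
        real n * (- (inverse t ^ Suc (Suc 0)) * inverse t ^ (n - Suc 0)) * exp (- inverse t)
        + exp (- inverse t) * inverse t ^ Suc (Suc 0) * inverse t ^ n) (at t)"
      by (rule DERIV_mult)
    moreover have "real n * (- (inverse t ^ Suc (Suc 0)) * inverse t ^ (n - Suc 0)) * exp (- inverse t)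
        + exp (- inverse t) * inverse t ^ Suc (Suc 0) * inverse t ^ n = flat (n + 2) t - n * flat (n + 1) t"
      using 3 by (cases n) (simp_all add: flat_def algebra_simps)
    ultimately have "((\<lambda>t. inverse t ^ n * exp (- inverse t)) has_real_derivative
        flat (n + 2) t - n * flat (n + 1) t) (at t)"
      by simp
    then show ?thesis
      by (rule has_field_derivative_transform_within_open[of _ _ _ "{0<..}"]) (use 3 in \<open>auto simp: flat_def\<close>)
  qed
qed

lemma smooth_flat: "smooth_on UNIV (flat n)"
proof -
  have "Ck_on k UNIV (flat n)" for k
  proof (induction k arbitrary: n)
    case 0
    show ?case
      unfolding Ck_on.simps by (rule DERIV_continuous_on) (rule flat_has_derivative)
  next
    case (Suc k)
    \<comment> \<open>The hypothesis is used for \<open>n + 1\<close> and \<open>n + 2\<close>,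
      which is why \<open>n\<close> is arbitrary in the induction over \<open>k\<close>.\<close>
    have "Ck_on k UNIV (\<lambda>t. v *\<^sub>R (flat (n + 2) t + (- real n) *\<^sub>R flat (n + 1) t))" for v
      by (intro bounded_bilinear.Ck_on[OF bounded_bilinear_scaleR] Ck_on_add Ck_on_const Suc open_UNIV)
    then show ?case
      by (rule Ck_on_SucI[rotated -1, where F="\<lambda>t v. v *\<^sub>R (flat (n + 2) t + (- real n) *\<^sub>R flat (n + 1) t)"])
         (use flat_has_derivative in \<open>auto simp: has_field_derivative_def mult_commute_abs\<close>)
  qed
  then show ?thesis by (simp add: smooth_on_def)
qed

text \<open>In a chart around \<open>p\<close> the function is \<open>flat 0\<close> of
  \<open>e^2 - |z - z0|^2\<close>, divided by its value at the centre \<open>z0\<close>. The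
  preimage \<open>K\<close> of the closed ball is compact, hence closed in the Hausdorff manifold,
  so the chart domain and \<open>- K\<close> form an open cover on which extension by zero is
  smooth.\<close>

lemma (in manifold) bump_function:
  assumes U: "open U" "p \<in> U"
  obtains \<phi> :: "'a \<Rightarrow> real" and K where
    "smooth_fun_on A UNIV \<phi>" "\<phi> p = 1" "closed K" "K \<subseteq> U" "\<And>q. q \<notin> K \<Longrightarrow> \<phi> q = 0"
proof -
  define c where "c = chart_at A p"
  have c: "c \<in> A" "p \<in> fst c" by (auto simp: c_def)
  obtain e where e: "e > 0" "cball (snd c p) e \<subseteq> snd c ` (U \<inter> fst c)"
    using open_chart_image[OF c(1) U(1)] U c unfolding open_contains_cball by blast
  define K where "K = chart_inv c ` cball (snd c p) e"
  have "continuous_on (cball (snd c p) e) (chart_inv c)"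
    by (rule continuous_on_subset[of "snd c ` fst c"])
       (use homeo_chart[OF c(1)] e in \<open>auto simp: homeomorphism_def\<close>)
  then have K: "closed K"
    by (auto simp: K_def intro!: compact_imp_closed compact_continuous_image)
  have KU: "K \<subseteq> U" and Kc: "K \<subseteq> fst c"
    using e c by (auto simp: K_def)
  define r where "r z = e\<^sup>2 - (z - snd c p) \<bullet> (z - snd c p)" for z
  define \<psi> where "\<psi> z = inverse (flat 0 (e\<^sup>2)) *\<^sub>R (flat 0 \<circ> r) z" for z
  have "smooth_on UNIV r"
    unfolding r_def
    by (intro smooth_on_diff smooth_on_inner smooth_on_const smooth_on_linear bounded_linear_ident open_UNIV)
  then have \<psi>: "smooth_on UNIV \<psi>"
    unfolding \<psi>_def
    by (intro smooth_on_scaleR smooth_on_const smooth_on_compose[OF _ _ _ smooth_flat] open_UNIV) auto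
  define \<phi> where "\<phi> q = (if q \<in> fst c then \<psi> (snd c q) else 0)" for q
  have zero: "\<phi> q = 0" if "q \<notin> K" for q
  proof (cases "q \<in> fst c")
    case True
    then have "snd c q \<notin> cball (snd c p) e"
      using that c chart_inv_left[of c q] by (auto simp: K_def image_iff simp del: mem_cball)
    then have "e \<le> norm (snd c q - snd c p)" by (simp add: dist_norm norm_minus_commute)
    then have "e\<^sup>2 \<le> (norm (snd c q - snd c p))\<^sup>2" using e(1) by (intro power_mono) auto
    then have "r (snd c q) \<le> 0" by (simp add: r_def dot_square_norm)
    then show ?thesis by (simp add: \<phi>_def \<psi>_def flat_nonpos)
  qed (simp add: \<phi>_def)
  have "smooth_fun_on A UNIV \<phi>"
  proof (rule smooth_fun_on_local)
    fix q :: 'a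
    consider "q \<in> fst c" | "q \<notin> K" using Kc by blast
    then show "\<exists>V. open V \<and> q \<in> V \<and> smooth_fun_on A (UNIV \<inter> V) \<phi>"
    proof cases
      case 1
      have S: "open (snd c ` fst c)"
        using open_chart_image'[OF c(1) open_chart[OF c(1)]] by simp
      have "smooth_on (snd c ` fst c) (\<phi> \<circ> chart_inv c)"
        by (rule smooth_on_cong[OF S, THEN iffD1, OF _ smooth_on_subset[OF \<psi> subset_UNIV]])
           (use c in \<open>auto simp: \<phi>_def\<close>)
      from smooth_fun_on_chartI[OF c(1) open_chart[OF c(1)] order_refl this] 1 show ?thesis
        using open_chart[OF c(1)] by auto
    next
      case 2
      have "smooth_fun_on A (- K) \<phi>"
        by (rule smooth_fun_on_cong[THEN iffD1, OF _ _ smooth_fun_on_const[of _ 0]]) (use K zero in auto)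
      with 2 K show ?thesis by (intro exI[of _ "- K"]) auto
    qed
  qed
  moreover have "\<phi> p = 1"
    using c e(1) flat_pos[of "e\<^sup>2" 0] by (simp add: \<phi>_def \<psi>_def r_def)
  ultimately show ?thesis using that K KU zero by blast
qed

lemma span_image_sum:
  assumes "v \<in> span (f ` I)" "finite I"
  obtains a where "v = (\<Sum>j\<in>I. a j *\<^sub>R f j)"
proof -
  have "\<exists>a. v = (\<Sum>j\<in>I. a j *\<^sub>R f j)" using assms(1)
  proof (induction rule: span_induct_alt)
    case base
    show ?case by (intro exI[of _ "\<lambda>_. 0"]) simp
  next
    case (step c x y)
    then obtain k a where k: "k \<in> I" "x = f k" "y = (\<Sum>j\<in>I. a j *\<^sub>R f j)" by auto
    have "(\<Sum>j\<in>I. (a j + (if j = k then c else 0)) *\<^sub>R f j)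
        = (\<Sum>j\<in>I. a j *\<^sub>R f j) + (\<Sum>j\<in>I. if j = k then c *\<^sub>R f j else 0)"
      by (auto simp: scaleR_left_distrib sum.distrib intro!: sum.cong)
    also have "\<dots> = c *\<^sub>R x + y" using k assms(2) by simp
    finally show ?case by metis
  qed
  then show ?thesis using that by blast
qed

text \<open>A combination of \<open>F\<close> with constant coefficients that gives \<open>v\<close>
  at \<open>p\<close> is cut off by a bump function. It is stated for spanning families so that it
  serves subbundles and the lightlike transversal bundle alike.\<close>

lemma (in manifold_map) section_through:
  assumes U: "open U" "p \<in> U" and F: "\<And>j. j < n \<Longrightarrow> smooth_along A A' i U (F j)"
    and E: "\<And>q. q \<in> U \<Longrightarrow> span ((\<lambda>j. F j q) ` {..<n::nat}) = E q" "\<And>q. 0 \<in> E q"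
    and v: "v \<in> E p"
  obtains V where "V \<in> sections A A' i E" "V p = v"
proof -
  obtain a where a: "v = (\<Sum>j<n. a j *\<^sub>R F j p)"
    using span_image_sum[of v "\<lambda>j. F j p" "{..<n}"] v E(1)[OF U(2)] by auto
  obtain \<phi> :: "'b \<Rightarrow> real" and K where \<phi>: "smooth_fun_on A UNIV \<phi>" "\<phi> p = 1" "closed K" "K \<subseteq> U"
    and zero: "\<And>q. q \<notin> K \<Longrightarrow> \<phi> q = 0"
    using M.bump_function[OF U] by metis
  define V where "V q = (if q \<in> U then \<Sum>j<n. (\<phi> q *\<^sub>R a j) *\<^sub>R F j q else 0)" for q
  have "V q \<in> E q" for q
  proof (cases "q \<in> U")
    case True
    have "V q \<in> span ((\<lambda>j. F j q) ` {..<n})"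
      unfolding V_def using True by (auto intro!: span_sum intro: span_scale span_base)
    then show ?thesis using E(1)[OF True] by simp
  qed (simp add: V_def E)
  moreover have "smooth_along A A' i UNIV V"
  proof (rule smooth_along_local)
    fix q
    have "smooth_along A A' i U (\<lambda>q. \<Sum>j<n. (\<phi> q *\<^sub>R a j) *\<^sub>R F j q)"
      by (intro smooth_along_sum U F M.smooth_fun_on_scaleR M.smooth_fun_on_const
          M.smooth_fun_on_subset[OF \<phi>(1)]) auto
    then have 1: "smooth_along A A' i U V"
      by (rule smooth_along_cong[OF U(1), THEN iffD1, rotated]) (simp add: V_def)
    have 2: "smooth_along A A' i (- K) V"
      by (rule smooth_along_cong[THEN iffD1, OF _ _ smooth_along_zero]) (use \<phi> zero in \<open>auto simp: V_def\<close>)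
    show "\<exists>W. open W \<and> q \<in> W \<and> smooth_along A A' i (UNIV \<inter> W) V"
    proof (cases "q \<in> U")
      case True
      with 1 U show ?thesis by auto
    next
      case False
      with 2 \<phi> show ?thesis by (intro exI[of _ "- K"]) auto
    qed
  qed
  moreover have "V p = v" using U \<phi>(2) a by (simp add: V_def)
  ultimately show ?thesis using that by (auto simp: sections_def)
qed

lemma smooth_subbundle_span:
  "smooth_subbundle A A' i k E \<Longrightarrow> subspace (E p)"
  unfolding smooth_subbundle_def by (metis subspace_span)

lemma (in manifold_map) section_through_distribution:
  assumes "smooth_distribution A A' i E" "v \<in> E p"
  obtains V where "V \<in> sections A A' i E" "V p = v"
proof -
  obtain k where k: "smooth_subbundle A A' i k E"
    using assms(1) by (auto simp: smooth_distribution_def)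
  then obtain U F where U: "open U" "p \<in> U" "\<And>j. j < k \<Longrightarrow> smooth_along A A' i U (F j)"
    "\<And>q. q \<in> U \<Longrightarrow> span ((\<lambda>j. F j q) ` {..<k}) = E q"
    unfolding smooth_subbundle_def by metis
  show ?thesis
    by (rule section_through[OF U(1,2), where F=F and n=k and E=E and v=v])
       (use U assms(2) subspace_0[OF smooth_subbundle_span[OF k]] that in auto)
qed

section \<open>Linear algebra of a lightlike splitting\<close>

lemma component_eqI:
  assumes "subspace U" "subspace V" "U \<inter> V = {0}" "u \<in> U" "v - u \<in> V"
  shows "component U V v = u"
  unfolding component_def
proof (rule the_equality)
  fix u' assume u': "u' \<in> U \<and> v - u' \<in> V"
  then have "u' - u \<in> U" using assms by (auto intro: subspace_diff)
  moreover have "u' - u \<in> V"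
    using subspace_diff[OF assms(2,5), of "v - u'"] u' by simp
  ultimately have "u' - u \<in> {0}" unfolding assms(3)[symmetric] by (rule IntI)
  then show "u' = u" by simp
qed (use assms(4,5) in simp)

lemma component_exists:
  assumes "subspace U" "subspace V" "U \<inter> V = {0}" "v \<in> U + V"
  shows "component U V v \<in> U" "v - component U V v \<in> V"
proof -
  obtain u w where "u \<in> U" "w \<in> V" "v = u + w"
    using assms(4) by (auto simp: set_plus_def)
  then show "component U V v \<in> U" "v - component U V v \<in> V"
    using component_eqI[OF assms(1-3), of u v] by simp_all
qed

lemma component_diff:
  assumes "subspace U" "subspace V" "U \<inter> V = {0}" "v \<in> U + V" "w \<in> U + V"
  shows "component U V v - component U V w = component U V (v - w)"
proof (rule component_eqI[OF assms(1-3), symmetric])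
  note v = component_exists[OF assms(1-4)] and w = component_exists[OF assms(1-3,5)]
  show "component U V v - component U V w \<in> U"
    by (rule subspace_diff[OF assms(1) v(1) w(1)])
  show "v - w - (component U V v - component U V w) \<in> V"
    using subspace_diff[OF assms(2) v(2) w(2)] by (simp add: algebra_simps)
qed

lemma subspace_set_plus: "subspace U \<Longrightarrow> subspace V \<Longrightarrow> subspace (U + V)"
proof -
  assume "subspace U" "subspace V"
  moreover have "U + V = {x + y |x y. x \<in> U \<and> y \<in> V}" by (auto simp: set_plus_def)
  ultimately show ?thesis using subspace_sums[of U V] by simp
qed

lemma summand_subset:
  fixes U V :: "'e::real_vector set"
  shows "subspace U \<Longrightarrow> V \<subseteq> U + V" and "subspace V \<Longrightarrow> U \<subseteq> U + V"
  using set_plus_intro[of 0 U _ V] set_plus_intro[of _ U 0 V] subspace_0[of U] subspace_0[of V]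
  by fastforce+

section \<open>Complements with respect to an indefinite form\<close>

lemma nondegenerate_representation:
  fixes b :: "'e::euclidean_space \<Rightarrow> 'e \<Rightarrow> real"
  assumes b: "bilinear b" and nondeg: "nondegenerate_on b UNIV"
  obtains G where "linear G" "surj G" "\<And>u v. b u v = G u \<bullet> v"
proof -
  define G where "G u = (\<Sum>a\<in>Basis. b u a *\<^sub>R a)" for u
  have rep: "b u v = G u \<bullet> v" for u v
  proof -
    have "linear (b u)" using b by (simp add: bilinear_def)
    from linear_euclidean_sum[OF this, of v] show ?thesis
      by (simp add: G_def inner_sum_left inner_commute[of v] mult.commute[of "b u _"])
  qed
  have "linear G"
    by (rule linearI)
       (simp_all add: G_def bilinear_ladd[OF b] bilinear_lmul[OF b] scaleR_left_distrib sum.distrib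
          scaleR_sum_right)
  moreover have "inj G"
    unfolding linear_injective_0[OF \<open>linear G\<close>]
  proof (intro allI impI)
    fix u assume "G u = 0"
    then have "b u v = 0" for v by (simp add: rep)
    then show "u = 0" using nondeg by (simp add: nondegenerate_on_def)
  qed
  ultimately show ?thesis
    using that rep linear_inj_imp_surj by blast
qed

text \<open>An indefinite form gives no orthogonal projection onto \<open>V\<close>, so the
  Euclidean one is used. The Euclidean normal part \<open>z\<close> of \<open>x\<close> equals
  \<open>G v\<close> for some \<open>v\<close>; this \<open>v\<close> is \<open>b\<close>-orthogonal
  to \<open>V\<close>, whence \<open>0 = b v x = z \<bullet> z\<close>.\<close>

lemma nondegenerate_double_complement:
  fixes b :: "'e::euclidean_space \<Rightarrow> 'e \<Rightarrow> real"
  assumes b: "bilinear b" and nondeg: "nondegenerate_on b UNIV" and V: "subspace V"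
    and x: "\<And>v. (\<And>u. u \<in> V \<Longrightarrow> b v u = 0) \<Longrightarrow> b v x = 0"
  shows "x \<in> V"
proof -
  obtain G where G: "surj G" "\<And>u v. b u v = G u \<bullet> v"
    using nondegenerate_representation[OF b nondeg] by metis
  obtain y z where yz: "y \<in> span V" "\<And>w. w \<in> span V \<Longrightarrow> orthogonal z w" "x = y + z"
    using orthogonal_subspace_decomp_exists[of V x] by blast
  obtain v where v: "G v = z" using G(1) by (metis surjD)
  have "b v x = 0"
    by (rule x) (use yz(2) v in \<open>auto simp: G orthogonal_def span_base\<close>)
  then have "z \<bullet> z = 0"
    using yz v by (simp add: G inner_add_right orthogonal_def)
  then show ?thesis using yz V by (simp add: span_eq_iff[THEN iffD2])
qed

text \<open>The situation in one ambient tangent space: \<open>V\<close> is the tangent space of the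
  submanifold, \<open>R\<close> its radical, \<open>S\<close> the screen, \<open>T\<close> and
  \<open>L\<close> the screen and lightlike transversal spaces, with dual frames
  \<open>\<xi>\<close> of \<open>R\<close> and \<open>N\<close> of \<open>L\<close>.\<close>

locale lightlike_splitting =
  fixes b :: "'e::euclidean_space \<Rightarrow> 'e \<Rightarrow> real" and V R S T L :: "'e set"
    and r :: nat and \<xi> N :: "nat \<Rightarrow> 'e"
  assumes b: "bilinear b" and sym: "\<And>u v. b u v = b v u" and nondeg: "nondegenerate_on b UNIV"
    and V: "subspace V" and S: "subspace S" and T: "subspace T"
    and R_eq: "R = V \<inter> {v. \<forall>u\<in>V. b v u = 0}"
    and V_sum: "orth_direct_sum b V R S"
    and perp_sum: "orth_direct_sum b {v. \<forall>u\<in>V. b v u = 0} R T"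
    and R_span: "span (\<xi> ` {..<r}) = R" and L_span: "span (N ` {..<r}) = L"
    and dual: "\<And>j k. j < r \<Longrightarrow> k < r \<Longrightarrow> b (N j) (\<xi> k) = (if j = k then 1 else 0)"
    and N_orth: "\<And>j v. j < r \<Longrightarrow> v \<in> S \<union> T \<Longrightarrow> b (N j) v = 0"
begin

lemmas b_simps = bilinear_ladd[OF b] bilinear_radd[OF b] bilinear_lsub[OF b] bilinear_rsub[OF b]
  bilinear_lmul[OF b] bilinear_rmul[OF b] bilinear_lzero[OF b] bilinear_rzero[OF b]

lemma b_sum: "b (\<Sum>j\<in>I. c j *\<^sub>R F j) v = (\<Sum>j\<in>I. c j * b (F j) v)"
  "b v (\<Sum>j\<in>I. c j *\<^sub>R F j) = (\<Sum>j\<in>I. c j * b v (F j))"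
  by (induction I rule: infinite_finite_induct) (simp_all add: b_simps)

lemma R: "subspace R" and L: "subspace L"
  using subspace_span R_span L_span by metis+

lemma R_subset: "R \<subseteq> V" and R_orth: "x \<in> R \<Longrightarrow> u \<in> V \<Longrightarrow> b x u = 0"
  by (auto simp: R_eq)

lemma S_subset: "S \<subseteq> V" and T_orth: "t \<in> T \<Longrightarrow> u \<in> V \<Longrightarrow> b t u = 0"
proof -
  show "S \<subseteq> V"
    using V_sum summand_subset(1)[OF R, of S] by (simp add: orth_direct_sum_def)
  have "T \<subseteq> {v. \<forall>u\<in>V. b v u = 0}"
    using perp_sum summand_subset(1)[OF R, of T] by (simp add: orth_direct_sum_def)
  then show "t \<in> T \<Longrightarrow> u \<in> V \<Longrightarrow> b t u = 0" by blast
qed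

lemma L_orth: "u \<in> L \<Longrightarrow> v \<in> S \<union> T \<Longrightarrow> b u v = 0"
proof -
  assume "u \<in> L" and v: "v \<in> S \<union> T"
  then obtain a where "u = (\<Sum>j<r. a j *\<^sub>R N j)"
    using span_image_sum[of u N "{..<r}"] L_span by auto
  then show ?thesis using N_orth[OF _ v] by (simp add: b_sum)
qed

text \<open>Pairing with \<open>N j\<close> reads off the \<open>j\<close>-th coefficient of
  \<open>x\<close> in the frame \<open>\<xi>\<close>. This is how condition (i) detects the radical
  part of the bracket.\<close>

lemma R_zero:
  assumes x: "x \<in> R" and 0: "\<And>u. u \<in> L \<Longrightarrow> b u x = 0"
  shows "x = 0"
proof -
  obtain a where a: "x = (\<Sum>j<r. a j *\<^sub>R \<xi> j)"
    using span_image_sum[of x \<xi> "{..<r}"] x R_span by auto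
  have "a j = 0" if "j < r" for j
  proof -
    have "N j \<in> L" unfolding L_span[symmetric] using that by (intro span_base imageI) simp
    then have "b (N j) x = 0" by (rule 0)
    moreover have "b (N j) x = (\<Sum>k<r. a k * b (N j) (\<xi> k))"
      by (simp only: a b_sum)
    moreover have "\<dots> = (\<Sum>k<r. if j = k then a k else 0)"
      by (intro sum.cong refl) (simp add: dual[OF that])
    ultimately show ?thesis using that by simp
  qed
  then show ?thesis using a by simp
qed

lemma L_zero:
  assumes u: "u \<in> L" and 0: "\<And>x. x \<in> R \<Longrightarrow> b u x = 0"
  shows "u = 0"
proof -
  obtain a where a: "u = (\<Sum>j<r. a j *\<^sub>R N j)"
    using span_image_sum[of u N "{..<r}"] u L_span by auto
  have "a k = 0" if "k < r" for k
  proof -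
    have "\<xi> k \<in> R" unfolding R_span[symmetric] using that by (intro span_base imageI) simp
    then have "b u (\<xi> k) = 0" by (rule 0)
    moreover have "b u (\<xi> k) = (\<Sum>j<r. a j * b (N j) (\<xi> k))"
      by (simp only: a b_sum)
    moreover have "\<dots> = (\<Sum>j<r. if j = k then a j else 0)"
      by (intro sum.cong refl) (simp add: dual[OF _ that])
    ultimately show ?thesis using that by simp
  qed
  then show ?thesis using a by simp
qed

lemma RS_inter: "R \<inter> S = {0}" and RS_sum: "V = R + S"
  and RT_inter: "R \<inter> T = {0}" and RT_sum: "{v. \<forall>u\<in>V. b v u = 0} = R + T"
  using V_sum perp_sum by (auto simp: orth_direct_sum_def)

lemma VT_inter: "x \<in> V \<Longrightarrow> x \<in> T \<Longrightarrow> x = 0"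
proof -
  assume x: "x \<in> V" "x \<in> T"
  then have "x \<in> R" using T_orth by (auto simp: R_eq)
  with x show "x = 0" using RT_inter by blast
qed

text \<open>Elements of \<open>R\<close> are orthogonal to \<open>n + t\<close>, which lies in
  \<open>V\<close>, and to \<open>t\<close>, which is normal; so \<open>n\<close> pairs to zero with
  \<open>R\<close> and vanishes by duality. Then \<open>t\<close> is both tangent and in
  \<open>T\<close>.\<close>

lemma transversal_zero: "n \<in> L \<Longrightarrow> t \<in> T \<Longrightarrow> n + t \<in> V \<Longrightarrow> n = 0 \<and> t = 0"
proof -
  assume n: "n \<in> L" and t: "t \<in> T" and V: "n + t \<in> V"
  have "n = 0"
  proof (rule L_zero[OF n])
    fix x assume x: "x \<in> R"
    have "b (n + t) x = 0" "b t x = 0"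
      using R_orth[OF x V] T_orth[OF t, of x] R_subset x sym[of x "n + t"] by auto
    then show "b n x = 0" by (simp add: b_simps)
  qed
  then show ?thesis using VT_inter[of t] V t by simp
qed

lemma V_tr_inter: "V \<inter> (L + T) = {0}"
proof -
  have "x = 0" if "x \<in> V" "x \<in> L + T" for x
  proof -
    from that(2) obtain n t where "n \<in> L" "t \<in> T" "x = n + t"
      by (rule set_plus_elim)
    with transversal_zero[of n t] that(1) show ?thesis by simp
  qed
  moreover have "0 \<in> V \<inter> (L + T)"
    using subspace_0[OF V] subspace_0[OF subspace_set_plus[OF L T]] by blast
  ultimately show ?thesis by blast
qed

lemma T_VL_inter: "T \<inter> (V + L) = {0}"
proof -
  have "x = 0" if "x \<in> T" "x \<in> V + L" for x
  proof -
    from that(2) obtain v n where *: "v \<in> V" "n \<in> L" "x = v + n"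
      by (rule set_plus_elim)
    then have "(- n) + x \<in> V" "- n \<in> L" using subspace_neg[OF L] by auto
    with transversal_zero[of "- n" x] that(1) show ?thesis by simp
  qed
  moreover have "0 \<in> T \<inter> (V + L)"
    using subspace_0[OF T] subspace_0[OF subspace_set_plus[OF V L]] by blast
  ultimately show ?thesis by blast
qed

text \<open>The orthogonal complement of \<open>V + L + T\<close> vanishes: its elements lie in \<open>R + T\<close>, pairing with
  \<open>L\<close> kills the part in \<open>R\<close>, and what remains is orthogonal to the complement of \<open>V\<close>, hence lies in \<open>V\<close>.\<close>

lemma total: "x \<in> V + (L + T)"
proof (rule nondegenerate_double_complement[OF b nondeg subspace_set_plus[OF V subspace_set_plus[OF L T]]])
  fix v assume v: "\<And>u. u \<in> V + (L + T) \<Longrightarrow> b v u = 0"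
  have vV: "b v u = 0" if "u \<in> V" for u
    using v[OF set_plus_intro[OF that set_plus_intro[OF subspace_0[OF L] subspace_0[OF T]]]] by simp
  have vL: "b v u = 0" if "u \<in> L" for u
    using v[OF set_plus_intro[OF subspace_0[OF V] set_plus_intro[OF that subspace_0[OF T]]]] by simp
  have vT: "b v u = 0" if "u \<in> T" for u
    using v[OF set_plus_intro[OF subspace_0[OF V] set_plus_intro[OF subspace_0[OF L] that]]] by simp
  have "v \<in> R + T" using vV RT_sum by blast
  then obtain \<rho> t where \<rho>t: "\<rho> \<in> R" "t \<in> T" "v = \<rho> + t" by (rule set_plus_elim)
  have "\<rho> = 0"
  proof (rule R_zero[OF \<rho>t(1)])
    fix u assume u: "u \<in> L"
    then have "b u t = 0" using L_orth \<rho>t(2) by blast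
    then show "b u \<rho> = 0" using vL[OF u] \<rho>t(3) sym[of u] by (simp add: b_simps)
  qed
  then have vt: "v = t" using \<rho>t by simp
  have "v \<in> V"
  proof (rule nondegenerate_double_complement[OF b nondeg V])
    fix u assume "\<And>w. w \<in> V \<Longrightarrow> b u w = 0"
    then have "u \<in> R + T" using RT_sum by blast
    then obtain \<rho>' t' where u: "\<rho>' \<in> R" "t' \<in> T" "u = \<rho>' + t'" by (rule set_plus_elim)
    have "b v \<rho>' = 0" "b v t' = 0" using vV vT u R_subset by auto
    then show "b u v = 0" using u sym[of u v] by (simp add: b_simps)
  qed
  then have "v = 0" using VT_inter \<rho>t(2) vt by blast
  then show "b v x = 0" by (simp add: b_simps)
qed

lemma total': "x \<in> T + (V + L)"
  using total[of x] by (simp add: add_ac)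

end

text \<open>The last two assumptions are the pointwise form of the requirement on \<open>f\<close>
  and \<open>w\<close> that the definition imposes on sections of \<open>B'\<close>.\<close>

locale screen_generic_splitting = lightlike_splitting b V R S T L r \<xi> N
  for b :: "'e::euclidean_space \<Rightarrow> 'e \<Rightarrow> real" and V R S T L r \<xi> N +
  fixes J :: "'e \<Rightarrow> 'e" and B' :: "'e set"
  assumes J: "linear J" and JJ: "\<And>u. J (J u) = 3 *\<^sub>R J u + u" and J_sym: "\<And>u v. b (J u) v = b u (J v)"
    and J_R: "J ` R = R"
    and S_sum: "orth_direct_sum b S (J ` S \<inter> S) B'"
    and B': "subspace B'" and nondeg_B': "nondegenerate_on b B'"
    and f_B': "\<And>v. v \<in> B' \<Longrightarrow> component V (L + T) (J v) \<in> B'"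
    and w_B': "\<And>v. v \<in> B' \<Longrightarrow> component (L + T) V (J v) \<in> T"
begin

abbreviation "Bo \<equiv> J ` S \<inter> S"

lemma Bo: "subspace Bo"
  by (intro subspace_inter linear_subspace_image J S)

text \<open>If \<open>v = J u\<close> with \<open>u\<close> and \<open>v\<close> in
  \<open>S\<close>, the bronze identity gives \<open>J v = 3 v + u\<close>, again in
  \<open>S\<close>.\<close>

lemma J_Bo: "v \<in> Bo \<Longrightarrow> J v \<in> Bo"
  by (auto simp: JJ intro!: subspace_add[OF S] subspace_scale[OF S])

lemma B'_subset: "B' \<subseteq> S" and Bo_B': "u \<in> Bo \<Longrightarrow> v \<in> B' \<Longrightarrow> b u v = 0"
  using S_sum summand_subset(1)[OF Bo, of B'] unfolding orth_direct_sum_def by blast+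

lemma J_decomp: "J v = component V (L + T) (J v) + component (L + T) V (J v)"
proof -
  note tr = subspace_set_plus[OF L T]
  note c = component_exists[OF V tr V_tr_inter total[of "J v"]]
  have "component (L + T) V (J v) = J v - component V (L + T) (J v)"
    by (rule component_eqI[OF tr V]) (use c V_tr_inter in auto)
  then show ?thesis by simp
qed

text \<open>When \<open>v\<close> is a covariant derivative at the point, these three projections
  are the values of the radical second form, the screen connection and the screen second
  form.\<close>

abbreviation "hstar v \<equiv> component R S (component V (L + T) v)"
abbreviation "ostar v \<equiv> component S R (component V (L + T) v)"
abbreviation "hs v \<equiv> component T (V + L) v"

text \<open>Here \<open>a\<close> and \<open>c\<close> stand for the derivatives of
  \<open>JY\<close> along \<open>X\<close> and of \<open>JX\<close> along \<open>Y\<close>, and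
  \<open>E\<close> for the bracket. All projections are linear, so the conditions depend on
  \<open>a - c\<close> only, and this is \<open>J E\<close> modulo \<open>Bo\<close>.\<close>

lemma invariant_part_iff:
  assumes E: "E \<in> V" and ac: "a - c - J E \<in> Bo"
  shows "E \<in> Bo \<longleftrightarrow> (\<forall>Z\<in>B'. \<forall>N\<in>L.
      b (hstar a) (J N) + 3 * b (hstar c) N = b (hstar c) (J N) + 3 * b (hstar a) N \<and>
      b (ostar a) (component V (L + T) (J Z)) + b (hs a) (J Z) + 3 * b (ostar c) Z
        = b (ostar c) (component V (L + T) (J Z)) + b (hs c) (J Z) + 3 * b (ostar a) Z)"
    (is "_ \<longleftrightarrow> (\<forall>Z\<in>B'. \<forall>N\<in>L. ?P N \<and> ?Q Z)")
proof -
  let ?f = "\<lambda>v. component V (L + T) (J v)" and ?w = "\<lambda>v. component (L + T) V (J v)"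
  note tr = subspace_set_plus[OF L T]
  obtain \<rho> \<sigma> where \<rho>: "\<rho> \<in> R" "\<sigma> \<in> S" "E = \<rho> + \<sigma>"
    using E unfolding RS_sum by (rule set_plus_elim)
  have "\<sigma> \<in> Bo + B'" using \<rho>(2) S_sum by (simp add: orth_direct_sum_def)
  then obtain \<beta> \<beta>' where \<beta>: "\<beta> \<in> Bo" "\<beta>' \<in> B'" "\<sigma> = \<beta> + \<beta>'" by (rule set_plus_elim)
  define s where "s = a - c - J E"
  have s: "s \<in> Bo" using ac by (simp add: s_def)
  define x where "x = J \<beta> + ?f \<beta>' + s"
  have xS: "x \<in> S"
    unfolding x_def using J_Bo[OF \<beta>(1)] f_B'[OF \<beta>(2)] s B'_subset by (auto intro!: subspace_add S)
  have J\<rho>: "J \<rho> \<in> R" using \<rho>(1) J_R by blast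
  have w: "?w \<beta>' \<in> T" using w_B' \<beta> by blast
  have "a - c = J \<rho> + (J \<beta> + J \<beta>') + s"
    by (simp add: s_def \<rho>(3) \<beta>(3) linear_add[OF J])
  \<comment> \<open>Sorted by summands: \<open>J \<rho>\<close> in \<open>R\<close>,
    \<open>x\<close> in \<open>S\<close>, \<open>?w \<beta>'\<close> in \<open>T\<close>, and
    nothing in \<open>L\<close>. The three projections of \<open>a - c\<close> can now be read
    off.\<close>
  then have ac_eq: "a - c = J \<rho> + x + ?w \<beta>'"
    by (subst (asm) J_decomp[of \<beta>']) (simp add: x_def add_ac)
  have tan: "component V (L + T) (a - c) = J \<rho> + x"
  proof (rule component_eqI[OF V tr V_tr_inter])
    show "J \<rho> + x \<in> V" using J\<rho> xS RS_sum by (auto intro: set_plus_intro)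
    show "a - c - (J \<rho> + x) \<in> L + T"
      using ac_eq w subspace_0[OF L] set_plus_intro[of 0 L "?w \<beta>'" T] by simp
  qed
  have tan_mem: "component V (L + T) v \<in> R + S" for v
    using component_exists(1)[OF V tr V_tr_inter total] RS_sum by simp
  have tan_diff: "component V (L + T) a - component V (L + T) c = J \<rho> + x"
    using component_diff[OF V tr V_tr_inter total total, of a c] tan by simp
  have h: "hstar a = hstar c + J \<rho>"
  proof -
    have "hstar a - hstar c = component R S (J \<rho> + x)"
      using component_diff[OF R S RS_inter tan_mem tan_mem] tan_diff by simp
    also have "\<dots> = J \<rho>" by (rule component_eqI[OF R S RS_inter]) (use J\<rho> xS in auto)
    finally show ?thesis by (simp add: algebra_simps)
  qed
  have o: "ostar a = ostar c + x"
  proof -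
    have SR: "S \<inter> R = {0}" using RS_inter by (simp add: Int_commute)
    have "ostar a - ostar c = component S R (J \<rho> + x)"
      using component_diff[OF S R SR, of "component V (L + T) a" "component V (L + T) c"] tan_mem tan_diff
      by (simp add: add.commute)
    also have "\<dots> = x" by (rule component_eqI[OF S R SR]) (use J\<rho> xS in auto)
    finally show ?thesis by (simp add: algebra_simps)
  qed
  have hs: "hs a = hs c + ?w \<beta>'"
  proof -
    note VL = subspace_set_plus[OF V L]
    have "hs a - hs c = hs (a - c)"
      using component_diff[OF T VL T_VL_inter total' total'] by simp
    also have "\<dots> = ?w \<beta>'"
    proof (rule component_eqI[OF T VL T_VL_inter w])
      have "J \<rho> + x \<in> V" using J\<rho> xS RS_sum by (auto intro: set_plus_intro)
      then show "a - c - ?w \<beta>' \<in> V + L"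
        using ac_eq subspace_0[OF L] set_plus_intro[of "J \<rho> + x" V 0 L] by simp
    qed
    finally show ?thesis by (simp add: algebra_simps)
  qed
  \<comment> \<open>Only the \<open>J \<rho>\<close> by which the two radical parts differ survives,
    and the bronze identity lets its two pairings combine to \<open>b \<rho> N\<close>.\<close>
  have P: "?P N \<longleftrightarrow> b N \<rho> = 0" for N
  proof -
    have "b (J \<rho>) (J N) = 3 * b (J \<rho>) N + b \<rho> N"
      using J_sym[of "J \<rho>" N] by (simp add: JJ b_simps)
    then show ?thesis by (simp add: h b_simps sym[of N \<rho>])
  qed
  have Q: "?Q Z \<longleftrightarrow> b \<beta>' Z = 0" if Z: "Z \<in> B'" for Z
  proof -
    \<comment> \<open>The summands \<open>J \<beta>\<close> and \<open>s\<close> of \<open>x\<close>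
      lie in \<open>Bo\<close> and are orthogonal to \<open>B'\<close>, so pairings with
      \<open>Z\<close> and with its tangential image see only \<open>?f \<beta>'\<close>.\<close>
    have Bo_part: "b x v = b (?f \<beta>') v" if "v \<in> B'" for v
      using Bo_B'[OF J_Bo[OF \<beta>(1)] that] Bo_B'[OF s that] by (simp add: x_def b_simps)
    have V_part: "v \<in> V" if "v \<in> B'" for v using that B'_subset S_subset by blast
    have "b (J \<beta>') (J Z) = 3 * b (J \<beta>') Z + b \<beta>' Z"
      using J_sym[of "J \<beta>'" Z] by (simp add: JJ b_simps)
    moreover have "b (J \<beta>') (J Z) = b (?f \<beta>') (?f Z) + b (?w \<beta>') (J Z)"
    proof -
      have "b (J \<beta>') (J Z) = b (?f \<beta>') (J Z) + b (?w \<beta>') (J Z)"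
        by (subst J_decomp[of \<beta>']) (simp add: b_simps)
      \<comment> \<open>The transversal part of \<open>J Z\<close> lies in \<open>T\<close>, hence
        is orthogonal to the tangent vector \<open>?f \<beta>'\<close>; a component in
        \<open>L\<close> could contribute if \<open>?f \<beta>'\<close> had a radical part.\<close>
      moreover have "b (?f \<beta>') (J Z) = b (?f \<beta>') (?f Z)"
        using T_orth[OF w_B'[OF Z] V_part[OF f_B'[OF \<beta>(2)]]] sym[of "?f \<beta>'" "?w Z"]
        by (subst J_decomp[of Z]) (simp add: b_simps)
      ultimately show ?thesis by simp
    qed
    moreover have "b (J \<beta>') Z = b (?f \<beta>') Z"
      using T_orth[OF w V_part[OF Z]] by (subst J_decomp[of \<beta>']) (simp add: b_simps)
    ultimately show ?thesis
      by (simp add: o hs b_simps Bo_part[OF f_B'[OF Z]] Bo_part[OF Z])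
  qed
  show ?thesis
  proof
    assume "E \<in> Bo"
    then have "\<rho> + (\<beta> + \<beta>') \<in> Bo" using \<rho> \<beta> by simp
    then have 1: "\<rho> + \<beta>' \<in> Bo"
      using subspace_diff[OF Bo _ \<beta>(1), of "\<rho> + (\<beta> + \<beta>')"] by (simp add: add.assoc)
    then have "\<rho> + \<beta>' - \<beta>' \<in> S" using \<beta>(2) B'_subset by (blast intro: subspace_diff[OF S])
    then have "\<rho> = 0" using \<rho>(1) RS_inter by auto
    moreover from this 1 have "\<beta>' = 0" using S_sum \<beta>(2) by (auto simp: orth_direct_sum_def)
    ultimately show "\<forall>Z\<in>B'. \<forall>N\<in>L. ?P N \<and> ?Q Z"
      using P Q by (simp add: b_simps)
  next
    assume *: "\<forall>Z\<in>B'. \<forall>N\<in>L. ?P N \<and> ?Q Z"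
    have "\<rho> = 0"
      \<comment> \<open>The two conditions share their quantifiers. The zero vector of
        \<open>B'\<close> inhabits the other range here, and that of \<open>L\<close> does so for
        \<open>\<beta>'\<close> below.\<close>
      by (rule R_zero[OF \<rho>(1)]) (use * P subspace_0[OF B'] in blast)
    moreover have "\<beta>' = 0"
      using nondeg_B' \<beta>(2) * Q subspace_0[OF L] unfolding nondegenerate_on_def by blast
    ultimately show "E \<in> Bo" using \<rho> \<beta> by simp
  qed
qed

end

section \<open>Integrability of the invariant part\<close>

context manifold_map
begin

lemma subspace_tangent_bundle: "subspace (tangent_bundle A A' i p)"
  unfolding tangent_bundle_def by (intro linear_subspace_image linear_differential subspace_UNIV)

lemma smooth_distribution_subspace: "smooth_distribution A A' i E \<Longrightarrow> subspace (E p)"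
  by (auto simp: smooth_distribution_def smooth_subbundle_span)

lemma lightlike_transversal_frame:
  assumes "lightlike_transversal_bundle A A' i g r S T L"
  obtains U \<xi> N where "open U" "p \<in> U" "\<And>j. j < r \<Longrightarrow> smooth_along A A' i U (N j)"
    "\<And>q. q \<in> U \<Longrightarrow> span ((\<lambda>j. \<xi> j q) ` {..<r}) = radical A A' i g q"
    "\<And>q. q \<in> U \<Longrightarrow> span ((\<lambda>j. N j q) ` {..<r}) = L q"
    "\<And>q j k. q \<in> U \<Longrightarrow> j < r \<Longrightarrow> k < r \<Longrightarrow> g (i q) (N j q) (\<xi> k q) = (if j = k then 1 else 0)"
    "\<And>q j v. q \<in> U \<Longrightarrow> j < r \<Longrightarrow> v \<in> S q \<union> T q \<Longrightarrow> g (i q) (N j q) v = 0"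
proof -
  obtain U \<xi> N where U: "open U" "p \<in> U"
    and smooth: "\<forall>j<r. smooth_along A A' i U (\<xi> j) \<and> smooth_along A A' i U (N j)"
    and frame: "\<forall>q\<in>U.
           inj_on (\<lambda>j::nat. \<xi> j q) {..<r} \<and> independent ((\<lambda>j. \<xi> j q) ` {..<r}) \<and>
           span ((\<lambda>j. \<xi> j q) ` {..<r}) = radical A A' i g q \<and>
           span ((\<lambda>j::nat. N j q) ` {..<r}) = L q \<and>
           (\<forall>j<r. \<forall>k<r. g (i q) (N j q) (\<xi> k q) = (if j = k then 1 else 0)) \<and>
           (\<forall>j<r. \<forall>k<r. g (i q) (N j q) (N k q) = 0) \<and>
           (\<forall>j<r. \<forall>v\<in>S q \<union> T q. g (i q) (N j q) v = 0)"
    using assms[unfolded lightlike_transversal_bundle_def, THEN spec, of p] by (elim exE conjE) (rule that)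
  show ?thesis
    by (rule that[OF U, of N \<xi>]) (use smooth frame in simp_all)
qed

text \<open>The conditions on \<open>f\<close> and \<open>w\<close> are assumed for global sections
  of \<open>B'\<close>. To obtain them for a single vector, it is extended to such a section by a
  bump function.\<close>

lemma screen_generic_splitting_at:
  assumes g: "semi_riemannian_metric A' k g" and J: "bronze_structure A' g J"
    and S: "screen_distribution A A' i g S" and T: "screen_transversal_bundle A A' i g T"
    and L: "lightlike_transversal_bundle A A' i g r S T L" and sg: "screen_generic A A' i g J S T L B'"
  obtains \<xi> N where "screen_generic_splitting (g (i p)) (tangent_bundle A A' i p) (radical A A' i g p)
    (S p) (T p) (L p) r \<xi> N (J (i p)) (B' p)"
proof -
  obtain U \<xi> N where "open U" and U: "p \<in> U" and "\<And>j. j < r \<Longrightarrow> smooth_along A A' i U (N j)" and frame: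
    "\<And>q. q \<in> U \<Longrightarrow> span ((\<lambda>j. \<xi> j q) ` {..<r}) = radical A A' i g q"
    "\<And>q. q \<in> U \<Longrightarrow> span ((\<lambda>j. N j q) ` {..<r}) = L q"
    "\<And>q j k. q \<in> U \<Longrightarrow> j < r \<Longrightarrow> k < r \<Longrightarrow> g (i q) (N j q) (\<xi> k q) = (if j = k then 1 else 0)"
    "\<And>q j v. q \<in> U \<Longrightarrow> j < r \<Longrightarrow> v \<in> S q \<union> T q \<Longrightarrow> g (i q) (N j q) v = 0"
    by (rule lightlike_transversal_frame[OF L, of p]) (rule that)
  have B'ext: "\<exists>V. V \<in> sections A A' i B' \<and> V p = v" if "v \<in> B' p" for v
    using section_through_distribution[of B' v p] sg that by (auto simp: screen_generic_def)
  have f: "component (tangent_bundle A A' i p) (L p + T p) (J (i p) v) \<in> B' p"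
    and w: "component (L p + T p) (tangent_bundle A A' i p) (J (i p) v) \<in> T p" if v: "v \<in> B' p" for v
  proof -
    obtain V where V: "V \<in> sections A A' i B'" "V p = v" using B'ext[OF v] by blast
    have "(\<lambda>p. f_part A A' i J T L p (V p)) \<in> sections A A' i B'"
      "(\<lambda>p. w_part A A' i J T L p (V p)) \<in> sections A A' i T"
      using sg V(1) unfolding screen_generic_def by blast+
    then have "f_part A A' i J T L p (V p) \<in> B' p" "w_part A A' i J T L p (V p) \<in> T p"
      by (simp_all add: sections_def)
    then show "component (tangent_bundle A A' i p) (L p + T p) (J (i p) v) \<in> B' p"
      "component (L p + T p) (tangent_bundle A A' i p) (J (i p) v) \<in> T p"
      by (simp_all add: f_part_def w_part_def V(2))
  qed
  have "screen_generic_splitting (g (i p)) (tangent_bundle A A' i p) (radical A A' i g p)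
    (S p) (T p) (L p) r (\<lambda>j. \<xi> j p) (\<lambda>j. N j p) (J (i p)) (B' p)"
  proof (intro screen_generic_splitting.intro lightlike_splitting.intro screen_generic_splitting_axioms.intro)
    show "bilinear (g (i p))" "nondegenerate_on (g (i p)) UNIV" "\<And>u v. g (i p) u v = g (i p) v u"
      using g unfolding semi_riemannian_metric_def by blast+
    show "subspace (tangent_bundle A A' i p)" by (rule subspace_tangent_bundle)
    show "subspace (S p)" "subspace (T p)" "subspace (B' p)"
      using S T sg smooth_distribution_subspace
      by (auto simp: screen_distribution_def screen_transversal_bundle_def screen_generic_def)
    show "radical A A' i g p = tangent_bundle A A' i p \<inter> {v. \<forall>u\<in>tangent_bundle A A' i p. g (i p) v u = 0}"
      by (simp add: radical_def normal_bundle_def)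
    show "orth_direct_sum (g (i p)) (tangent_bundle A A' i p) (radical A A' i g p) (S p)"
      using S by (simp add: screen_distribution_def)
    show "orth_direct_sum (g (i p)) {v. \<forall>u\<in>tangent_bundle A A' i p. g (i p) v u = 0} (radical A A' i g p) (T p)"
      using T by (simp add: screen_transversal_bundle_def normal_bundle_def)
    show "span ((\<lambda>j. \<xi> j p) ` {..<r}) = radical A A' i g p" "span ((\<lambda>j. N j p) ` {..<r}) = L p"
      "\<And>j k. j < r \<Longrightarrow> k < r \<Longrightarrow> g (i p) (N j p) (\<xi> k p) = (if j = k then 1 else 0)"
      "\<And>j v. j < r \<Longrightarrow> v \<in> S p \<union> T p \<Longrightarrow> g (i p) (N j p) v = 0"
      by (simp_all only: frame[OF U] U)
    show "linear (J (i p))" "\<And>u. J (i p) (J (i p) u) = 3 *\<^sub>R J (i p) u + u"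
      "\<And>u v. g (i p) (J (i p) u) v = g (i p) u (J (i p) v)"
      using J by (auto simp: bronze_structure_def smooth_endomorphism_field_def)
    show "J (i p) ` radical A A' i g p = radical A A' i g p"
      "orth_direct_sum (g (i p)) (S p) (J (i p) ` S p \<inter> S p) (B' p)" "nondegenerate_on (g (i p)) (B' p)"
      using sg by (auto simp: screen_generic_def invariant_part_def)
  qed (use f w in auto)
  then show ?thesis by (rule that)
qed

text \<open>The bundle \<open>L\<close> is given through local frames and not as a
  \<open>smooth_distribution\<close>, so these frames are passed to \<open>section_through\<close>
  directly.\<close>

lemma section_through_transversal:
  assumes L: "lightlike_transversal_bundle A A' i g r S T L" and v: "v \<in> L p"
  obtains V where "V \<in> sections A A' i L" "V p = v"
proof -
  have zero: "0 \<in> L q" for q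
  proof (rule lightlike_transversal_frame[OF L, of q])
    fix U N assume "q \<in> U" "\<And>q. q \<in> U \<Longrightarrow> span ((\<lambda>j. N j q) ` {..<r}) = L q"
    then show "0 \<in> L q" using span_zero by blast
  qed
  show ?thesis
  proof (rule lightlike_transversal_frame[OF L, of p])
    fix U N assume "open U" "p \<in> U" "\<And>j. j < r \<Longrightarrow> smooth_along A A' i U (N j)"
      "\<And>q. q \<in> U \<Longrightarrow> span ((\<lambda>j. N j q) ` {..<r}) = L q"
    from section_through[OF this zero v] that show ?thesis by blast
  qed
qed

text \<open>After \<open>J\<close> is moved out of both derivatives, torsion-freeness cancels
  everything but the \<open>(l,m)\<close> corrections. They are kept explicit: as combinations of
  \<open>dX\<close>, \<open>dY\<close> and their images under \<open>J\<close>, they fall into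
  \<open>B\<^sub>o\<close> as soon as \<open>dX\<close> and \<open>dY\<close> do.\<close>

lemma covariant_bracket:
  fixes l m :: "'a \<Rightarrow> real" and \<eta> :: "'a \<Rightarrow> 'e" and p :: 'b
  assumes g: "semi_riemannian_metric A' k g" and J: "bronze_structure A' g J"
    and nabla: "levi_civita_connection A' g nabla" and par: "parallel_endomorphism A' nabla J"
    and X: "smooth_field A UNIV X" and Y: "smooth_field A UNIV Y"
  defines "\<Omega> \<equiv> lm_connection g J nabla l m \<eta>"
    and "dX \<equiv> differential A A' i p (X p)" and "dY \<equiv> differential A A' i p (Y p)"
  shows "cov_along A A' i \<Omega> p (X p) (J_image A A' i J Y) - cov_along A A' i \<Omega> p (Y p) (J_image A A' i J X)
      - J (i p) (differential A A' i p (lie_bracket A X Y p))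
    = g (i p) (J (i p) dY) (\<eta> (i p)) *\<^sub>R (l (i p) *\<^sub>R dX + m (i p) *\<^sub>R J (i p) dX)
    - g (i p) (J (i p) dX) (\<eta> (i p)) *\<^sub>R (l (i p) *\<^sub>R dY + m (i p) *\<^sub>R J (i p) dY)"
proof -
  have bil: "bilinear (g (i p))"
    using g by (simp add: semi_riemannian_metric_def)
  have Js: "smooth_endomorphism_field A' J" and Jlin: "linear (J (i p))"
    using J by (simp_all add: bronze_structure_def smooth_endomorphism_field_def)
  have aff: "affine_connection A' nabla"
    using nabla by (simp add: levi_civita_connection_def)
  have JZ: "cov_along A A' i nabla p u (J_image A A' i J Z)
      = J (i p) (cov_along A A' i nabla p u (\<lambda>q. differential A A' i q (Z q)))"
    if "smooth_field A UNIV Z" for u Z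
    using cov_along_parallel[OF aff Js par smooth_along_differential[OF that]]
    by (simp add: J_image_def[abs_def])
  show ?thesis
    unfolding \<Omega>_def cov_along_lm_connection[of g p J nabla, OF bil] JZ[OF X] JZ[OF Y]
      cov_along_torsion_free[OF nabla X Y, symmetric] linear_diff[OF Jlin]
    by (simp add: J_image_def dX_def dY_def)
qed

end

theorem theorem5p7:
  fixes A' :: "('a::{t2_space,second_countable_topology}, 'e::euclidean_space) chart set"
    and A :: "('b::{t2_space,second_countable_topology}, 'm::euclidean_space) chart set"
    and i :: "'b \<Rightarrow> 'a"
    and g :: "'a \<Rightarrow> 'e \<Rightarrow> 'e \<Rightarrow> real"
    and J :: "'a \<Rightarrow> 'e \<Rightarrow> 'e"
    and nabla :: "'a \<Rightarrow> 'e \<Rightarrow> ('a \<Rightarrow> 'e) \<Rightarrow> 'e"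
    and S T L B' :: "'b \<Rightarrow> 'e set"
    and l m :: "'a \<Rightarrow> real"
    and \<eta> :: "'a \<Rightarrow> 'e"
    and k r :: nat
  assumes "locally_bronze_manifold A' k g J nabla"
    and "lightlike_submanifold A A' i g r"
    and "screen_distribution A A' i g S"
    and "screen_transversal_bundle A A' i g T"
    and "lightlike_transversal_bundle A A' i g r S T L"
    and "screen_generic A A' i g J S T L B'"
    and "smooth_fun_on A' UNIV l" and "smooth_fun_on A' UNIV m"
    and "(l, m) \<noteq> ((\<lambda>_. 0), (\<lambda>_. 0))"
    and "smooth_field A' UNIV \<eta>" and "\<And>p. g p (\<eta> p) (\<eta> p) = 1"
  defines "Omega \<equiv> lm_connection g J nabla l m \<eta>"
  defines "Omega_star \<equiv> screen_connection A A' i g S T L Omega"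
    and "h_star \<equiv> radical_second_form A A' i g S T L Omega"
    and "h_s \<equiv> screen_second_form A A' i T L Omega"
    and "f \<equiv> f_part A A' i J T L"
    and "JJ \<equiv> J_image A A' i J"
    and "Bo \<equiv> invariant_part i J S"
  shows "integrable_distribution A A' i Bo \<longleftrightarrow>
    (\<forall>X\<in>tangent_sections A A' i Bo. \<forall>Y\<in>tangent_sections A A' i Bo.
     \<forall>Z\<in>sections A A' i B'. \<forall>N\<in>sections A A' i L.
      (\<forall>p. g (i p) (h_star p (X p) (JJ Y)) (J (i p) (N p)) + 3 * g (i p) (h_star p (Y p) (JJ X)) (N p)
         = g (i p) (h_star p (Y p) (JJ X)) (J (i p) (N p)) + 3 * g (i p) (h_star p (X p) (JJ Y)) (N p)) \<and>
      (\<forall>p. g (i p) (Omega_star p (X p) (JJ Y)) (f p (Z p)) + g (i p) (h_s p (X p) (JJ Y)) (J (i p) (Z p))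
           + 3 * g (i p) (Omega_star p (Y p) (JJ X)) (Z p)
         = g (i p) (Omega_star p (Y p) (JJ X)) (f p (Z p)) + g (i p) (h_s p (Y p) (JJ X)) (J (i p) (Z p))
           + 3 * g (i p) (Omega_star p (X p) (JJ Y)) (Z p)))"
proof -
  have bronze: "smooth_manifold A'" "semi_riemannian_metric A' k g" "bronze_structure A' g J"
    "levi_civita_connection A' g nabla" "parallel_endomorphism A' nabla J"
    using assms(1) by (simp_all add: locally_bronze_manifold_def)
  interpret manifold_map A A' i
    using assms(2) by unfold_locales (simp_all add: lightlike_submanifold_def immersed_submanifold_def)
  \<comment> \<open>The two conditions see \<open>N\<close> and \<open>Z\<close> only through their
    values at \<open>p\<close>, so they are restated for single vectors \<open>n\<close> and
    \<open>z\<close>, the form in which the linear algebra applies.\<close>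
  define P where "P X Y p n \<longleftrightarrow>
      g (i p) (h_star p (X p) (JJ Y)) (J (i p) n) + 3 * g (i p) (h_star p (Y p) (JJ X)) n
    = g (i p) (h_star p (Y p) (JJ X)) (J (i p) n) + 3 * g (i p) (h_star p (X p) (JJ Y)) n" for X Y p n
  define Q where "Q X Y p z \<longleftrightarrow>
      g (i p) (Omega_star p (X p) (JJ Y)) (f p z) + g (i p) (h_s p (X p) (JJ Y)) (J (i p) z)
        + 3 * g (i p) (Omega_star p (Y p) (JJ X)) z
    = g (i p) (Omega_star p (Y p) (JJ X)) (f p z) + g (i p) (h_s p (Y p) (JJ X)) (J (i p) z)
        + 3 * g (i p) (Omega_star p (X p) (JJ Y)) z" for X Y p z
  have pointwise: "differential A A' i p (lie_bracket A X Y p) \<in> Bo p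
      \<longleftrightarrow> (\<forall>z\<in>B' p. \<forall>n\<in>L p. P X Y p n \<and> Q X Y p z)"
    if X: "X \<in> tangent_sections A A' i Bo" and Y: "Y \<in> tangent_sections A A' i Bo" for X Y p
  proof -
    obtain \<xi> N where "screen_generic_splitting (g (i p)) (tangent_bundle A A' i p) (radical A A' i g p)
        (S p) (T p) (L p) r \<xi> N (J (i p)) (B' p)"
      using screen_generic_splitting_at[OF bronze(2,3) assms(3-6)] .
    then interpret p: screen_generic_splitting "g (i p)" "tangent_bundle A A' i p" "radical A A' i g p"
        "S p" "T p" "L p" r \<xi> N "J (i p)" "B' p" .
    have Bo: "Bo p = J (i p) ` S p \<inter> S p" by (simp add: Bo_def invariant_part_def)
    have dX: "differential A A' i p (X p) \<in> Bo p" "differential A A' i p (Y p) \<in> Bo p"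
      using X Y by (auto simp: tangent_sections_def)
    have smooth: "smooth_field A UNIV X" "smooth_field A UNIV Y"
      using X Y by (auto simp: tangent_sections_def)
    have "cov_along A A' i Omega p (X p) (JJ Y) - cov_along A A' i Omega p (Y p) (JJ X)
        - J (i p) (differential A A' i p (lie_bracket A X Y p)) \<in> J (i p) ` S p \<inter> S p"
      unfolding Omega_def JJ_def covariant_bracket[OF bronze(2-5) smooth]
      using p.J_Bo dX unfolding Bo
      by (intro subspace_diff[OF p.Bo] subspace_scale[OF p.Bo] subspace_add[OF p.Bo]) blast+
    moreover have "differential A A' i p (lie_bracket A X Y p) \<in> tangent_bundle A A' i p"
      by (simp add: tangent_bundle_def)
    ultimately show ?thesis
      using p.invariant_part_iff unfolding Bo P_def Q_def h_star_def Omega_star_def h_s_def f_def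
        radical_second_form_def screen_connection_def screen_second_form_def induced_connection_def f_part_def
      by blast
  qed
  have extend: "(\<forall>p. \<forall>z\<in>B' p. \<forall>n\<in>L p. P X Y p n \<and> Q X Y p z) \<longleftrightarrow>
      (\<forall>Z\<in>sections A A' i B'. \<forall>N\<in>sections A A' i L. (\<forall>p. P X Y p (N p)) \<and> (\<forall>p. Q X Y p (Z p)))" for X Y
  proof
    assume *: "\<forall>Z\<in>sections A A' i B'. \<forall>N\<in>sections A A' i L. (\<forall>p. P X Y p (N p)) \<and> (\<forall>p. Q X Y p (Z p))"
    show "\<forall>p. \<forall>z\<in>B' p. \<forall>n\<in>L p. P X Y p n \<and> Q X Y p z"
    proof (intro allI ballI)
      fix p z n assume z: "z \<in> B' p" and n: "n \<in> L p"
      have "smooth_distribution A A' i B'" using assms(6) by (simp add: screen_generic_def)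
      from section_through_distribution[OF this z]
      obtain Z where Z: "Z \<in> sections A A' i B'" "Z p = z" .
      from section_through_transversal[OF assms(5) n]
      obtain N where N: "N \<in> sections A A' i L" "N p = n" .
      have "P X Y p (N p) \<and> Q X Y p (Z p)" using * Z(1) N(1) by blast
      then show "P X Y p n \<and> Q X Y p z" by (simp only: Z(2) N(2))
    qed
  next
    assume "\<forall>p. \<forall>z\<in>B' p. \<forall>n\<in>L p. P X Y p n \<and> Q X Y p z"
    then show "\<forall>Z\<in>sections A A' i B'. \<forall>N\<in>sections A A' i L. (\<forall>p. P X Y p (N p)) \<and> (\<forall>p. Q X Y p (Z p))"
      unfolding sections_def by blast
  qed
  \<comment> \<open>The bracket of smooth fields is always smooth, so integrability is just
    membership of its push-forward in \<open>Bo\<close> at every point.\<close>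
  have "integrable_distribution A A' i Bo \<longleftrightarrow>
      (\<forall>X\<in>tangent_sections A A' i Bo. \<forall>Y\<in>tangent_sections A A' i Bo.
        \<forall>p. differential A A' i p (lie_bracket A X Y p) \<in> Bo p)"
    by (auto simp: integrable_distribution_def tangent_sections_def M.smooth_lie_bracket)
  also have "\<dots> \<longleftrightarrow> (\<forall>X\<in>tangent_sections A A' i Bo. \<forall>Y\<in>tangent_sections A A' i Bo.
     \<forall>Z\<in>sections A A' i B'. \<forall>N\<in>sections A A' i L. (\<forall>p. P X Y p (N p)) \<and> (\<forall>p. Q X Y p (Z p)))"
    unfolding extend[symmetric] using pointwise by simp
  finally show ?thesis
    unfolding P_def Q_def .
qed

end
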